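(* Suppose that there are a constant $\beta>0$, a positive integer $d$ and a constant $C>0$ with $\sigma_i\le C e^{-\beta i^{1/d}}$ for all $i\ge1$. For $\ell\ge3$ let $Z=(z_i)_{i=1}^\ell$ be an $\ell$-point independent sample from $\mu$, and let $1\le s\le\ell$. Then $$\mathbb{E}\left[\int_{\mathcal{X}}\sqrt{k(x,x)-k_s^Z(x,x)}\,d\mu(x)\right]=\mathcal{O}\left(\sqrt{\sum_{i>s}\sigma_i}+\frac{(\log\ell)^{2d+1}}{\ell}\right),$$ and the same estimate holds for $\mathbb{E}\left[\int_{\mathcal{X}}(k(x,x)-k_s^Z(x,x))\,d\mu(x)\right]$. Moreover, there is an $(s+1)$-point randomized (depending on $Z$) convex quadrature rule $Q_{s+1}$ such that $\mathbb{E}[\mathrm{wce}(Q_{s+1};\mathcal{H}_k,\mu)]$ is of the same order. Here the constants implied by $\mathcal{O}$ do not depend on $\ell$ or $s$.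
   Context: $\mathcal{X}$ is a Hausdorff space, $\mu$ a (Borel) probability measure on $\mathcal{X}$, and $k:\mathcal{X}\times\mathcal{X}\to\mathbb{R}$ a bounded positive definite kernel (all Gram matrices are positive semi-definite; $\sup_x k(x,x)<\infty$) with reproducing kernel Hilbert space $\mathcal{H}_k$. The integral operator is $\mathcal{K}:L^2(\mu)\to L^2(\mu)$, $(\mathcal{K}f)(x)=\int_{\mathcal{X}}k(x,y)f(y)\,d\mu(y)$, with eigenpairs $(\sigma_i,e_i)_{i=1}^\infty$, $\sigma_1\ge\sigma_2\ge\cdots\ge0$, $(e_i)$ orthonormal in $L^2(\mu)$. Standing assumption: the Mercer decomposition $k(x,y)=\sum_{i=1}^\infty\sigma_i e_i(x)e_i(y)$ holds and $(\sqrt{\sigma_i}e_i)_{i}$ (over indices with $\sigma_i>0$) is an orthonormal basis of $\mathcal{H}_k$. Nyström approximation: for $Z=(z_i)_{i=1}^\ell$ put $k(Z,Z)=(k(z_i,z_j))_{i,j=1}^\ell$, $k(Z,x)=(k(z_i,x))_{i=1}^\ell\in\mathbb{R}^\ell$, $k(x,Z)=k(Z,x)^\top$. Fix $k(Z,Z)=U\,\mathrm{diag}(\lambda_1,\dots,\lambda_\ell)U^\top$ with $U=[u_1,\dots,u_\ell]$ orthogonal and $\lambda_1\ge\cdots\ge\lambda_\ell\ge0$. Then $$k_s^Z(x,y)=k(x,Z)k(Z,Z)_s^+k(Z,y)=\sum_{1\le i\le s,\ \lambda_i>0}\frac1{\lambda_i}(u_i^\top k(Z,x))(u_i^\top k(Z,y)).$$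 An $n$-point quadrature rule is $Q_n:f\mapsto\sum_{i=1}^nw_if(x_i)$ with $w_i\in\mathbb{R}$, $x_i\in\mathcal{X}$; it is convex if $w_i\ge0$ and $\sum_iw_i=1$. Its worst-case error is $\mathrm{wce}(Q_n;\mathcal{H}_k,\mu)=\sup_{\lVert f\rVert_{\mathcal{H}_k}\le1}|Q_n(f)-\int_{\mathcal{X}}f\,d\mu|$. *)

theory Defs
  imports "HOL-Probability.Probability"
begin

text \<open>Indices run from 1 throughout: eigenpairs over \<open>i \<ge> 1\<close>, sample points, matrix entries and
  quadrature nodes over \<open>{1..n}\<close>. Values at other indices are irrelevant.\<close>

section \<open>Kernels and their reproducing kernel Hilbert spaces\<close>

definition pos_def_kernel :: "('a \<Rightarrow> 'a \<Rightarrow> real) \<Rightarrow> bool" where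
  "pos_def_kernel k \<longleftrightarrow>
     (\<forall>x y. k x y = k y x) \<and>
     (\<forall>n (x :: nat \<Rightarrow> 'a) (c :: nat \<Rightarrow> real).
        0 \<le> (\<Sum>i=1..n. \<Sum>j=1..n. c i * c j * k (x i) (x j)))"

definition ip_norm :: "(('a \<Rightarrow> real) \<Rightarrow> ('a \<Rightarrow> real) \<Rightarrow> real) \<Rightarrow> ('a \<Rightarrow> real) \<Rightarrow> real" where
  "ip_norm ip f = sqrt (ip f f)"

text \<open>A linear space \<open>H\<close> of functions, with an inner product \<open>ip\<close> that is only meaningful on \<open>H\<close>.\<close>

locale hilbert_function_space =
  fixes H :: "('a \<Rightarrow> real) set"
    and ip :: "('a \<Rightarrow> real) \<Rightarrow> ('a \<Rightarrow> real) \<Rightarrow> real"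
  assumes zero_mem: "(\<lambda>x. 0) \<in> H"
    and add_mem: "\<And>f g. f \<in> H \<Longrightarrow> g \<in> H \<Longrightarrow> (\<lambda>x. f x + g x) \<in> H"
    and scale_mem: "\<And>c f. f \<in> H \<Longrightarrow> (\<lambda>x. c * f x) \<in> H"
    and ip_commute: "\<And>f g. f \<in> H \<Longrightarrow> g \<in> H \<Longrightarrow> ip f g = ip g f"
    and ip_add_left: "\<And>f g h. f \<in> H \<Longrightarrow> g \<in> H \<Longrightarrow> h \<in> H \<Longrightarrow>
          ip (\<lambda>x. f x + g x) h = ip f h + ip g h"
    and ip_scale_left: "\<And>c f g. f \<in> H \<Longrightarrow> g \<in> H \<Longrightarrow> ip (\<lambda>x. c * f x) g = c * ip f g"
    and ip_pos: "\<And>f. f \<in> H \<Longrightarrow> f \<noteq> (\<lambda>x. 0) \<Longrightarrow> 0 < ip f f"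
    and complete: "\<And>F :: nat \<Rightarrow> 'a \<Rightarrow> real. (\<And>n. F n \<in> H) \<Longrightarrow>
          (\<And>\<epsilon>. \<epsilon> > 0 \<Longrightarrow> \<exists>N. \<forall>m\<ge>N. \<forall>n\<ge>N. ip_norm ip (\<lambda>x. F m x - F n x) < \<epsilon>) \<Longrightarrow>
          \<exists>f\<in>H. (\<lambda>n. ip_norm ip (\<lambda>x. F n x - f x)) \<longlonglongrightarrow> 0"

text \<open>By the Moore--Aronszajn theorem, for a positive definite \<open>k\<close> these conditions determine
  \<open>H\<close>, and \<open>ip\<close> on \<open>H\<close>, uniquely.\<close>

locale rkhs = hilbert_function_space H ip
  for k :: "'a \<Rightarrow> 'a \<Rightarrow> real"
    and H :: "('a \<Rightarrow> real) set"
    and ip :: "('a \<Rightarrow> real) \<Rightarrow> ('a \<Rightarrow> real) \<Rightarrow> real" +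
  assumes kernel_mem: "\<And>x. k x \<in> H"
    and reproducing: "\<And>f x. f \<in> H \<Longrightarrow> ip f (k x) = f x"

text \<open>An orthonormal family in \<open>H\<close> with dense linear span.\<close>

definition orthonormal_basis_of ::
    "('a \<Rightarrow> real) set \<Rightarrow> (('a \<Rightarrow> real) \<Rightarrow> ('a \<Rightarrow> real) \<Rightarrow> real) \<Rightarrow> nat set \<Rightarrow> (nat \<Rightarrow> 'a \<Rightarrow> real) \<Rightarrow> bool"
  where
  "orthonormal_basis_of H ip I b \<longleftrightarrow>
     (\<forall>i\<in>I. b i \<in> H) \<and>
     (\<forall>i\<in>I. \<forall>j\<in>I. ip (b i) (b j) = (if i = j then 1 else 0)) \<and>
     (\<forall>f\<in>H. \<forall>\<epsilon>>0. \<exists>J c. finite J \<and> J \<subseteq> I \<and>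
        ip_norm ip (\<lambda>x. f x - (\<Sum>j\<in>J. c j * b j x)) < \<epsilon>)"

section \<open>The integral operator and its eigenpairs\<close>

definition integral_op :: "'a measure \<Rightarrow> ('a \<Rightarrow> 'a \<Rightarrow> real) \<Rightarrow> ('a \<Rightarrow> real) \<Rightarrow> 'a \<Rightarrow> real" where
  "integral_op M k f x = (\<integral>y. k x y * f y \<partial>M)"

text \<open>The \<open>e i\<close> are genuine functions, representing elements of \<open>L\<^sup>2(M)\<close>; the eigenvalue equation is
  one between elements of \<open>L\<^sup>2(M)\<close>, hence holds almost everywhere.\<close>

definition ordered_eigenpairs ::
    "'a measure \<Rightarrow> ('a \<Rightarrow> 'a \<Rightarrow> real) \<Rightarrow> (nat \<Rightarrow> real) \<Rightarrow> (nat \<Rightarrow> 'a \<Rightarrow> real) \<Rightarrow> bool" where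
  "ordered_eigenpairs M k \<sigma> e \<longleftrightarrow>
     (\<forall>i\<ge>1. 0 \<le> \<sigma> i) \<and>
     (\<forall>i\<ge>1. \<sigma> (Suc i) \<le> \<sigma> i) \<and>
     (\<forall>i\<ge>1. e i \<in> borel_measurable M \<and> integrable M (\<lambda>x. (e i x)\<^sup>2)) \<and>
     (\<forall>i\<ge>1. \<forall>j\<ge>1. (\<integral>x. e i x * e j x \<partial>M) = (if i = j then 1 else 0)) \<and>
     (\<forall>i\<ge>1. AE x in M. integral_op M k (e i) x = \<sigma> i * e i x)"

section \<open>Nystroem approximation\<close>

text \<open>\<open>A = U diag(lam) U\<^sup>T\<close> for an \<open>l \<times> l\<close> matrix \<open>A\<close>, with \<open>U\<close> orthogonal (the \<open>i\<close>-th column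
  \<open>\<lambda>r. U r i\<close> being the eigenvector for \<open>lam i\<close>) and \<open>lam 1 \<ge> \<dots> \<ge> lam l \<ge> 0\<close>.\<close>

definition ordered_eigendecomposition ::
    "nat \<Rightarrow> (nat \<Rightarrow> nat \<Rightarrow> real) \<Rightarrow> (nat \<Rightarrow> nat \<Rightarrow> real) \<Rightarrow> (nat \<Rightarrow> real) \<Rightarrow> bool" where
  "ordered_eigendecomposition l A U lam \<longleftrightarrow>
     (\<forall>i\<in>{1..l}. \<forall>j\<in>{1..l}. (\<Sum>r=1..l. U r i * U r j) = (if i = j then 1 else 0)) \<and>
     (\<forall>i\<in>{1..l}. \<forall>j\<in>{1..l}. A i j = (\<Sum>r=1..l. U i r * lam r * U j r)) \<and>
     (\<forall>i\<in>{1..l}. \<forall>j\<in>{1..l}. i \<le> j \<longrightarrow> lam j \<le> lam i) \<and>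
     (\<forall>i\<in>{1..l}. 0 \<le> lam i)"

text \<open>The eigendecomposition is an argument because for \<open>lam s = lam (s + 1) > 0\<close> the truncated
  pseudo-inverse depends on it. As a choice \<open>U Z, lam Z\<close> made separately for every sample need not be
  measurable in \<open>Z\<close>, joint measurability of \<open>(Z, x) \<mapsto> nystroem k l Z (U Z) (lam Z) s x x\<close> has to be
  required before expectations over \<open>Z\<close> make sense; it holds when \<open>U\<close> and \<open>lam\<close> are measurable in \<open>Z\<close>
  and \<open>k\<close> is measurable.\<close>

definition nystroem ::
    "('a \<Rightarrow> 'a \<Rightarrow> real) \<Rightarrow> nat \<Rightarrow> (nat \<Rightarrow> 'a) \<Rightarrow> (nat \<Rightarrow> nat \<Rightarrow> real) \<Rightarrow> (nat \<Rightarrow> real) \<Rightarrow> nat \<Rightarrow>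
     'a \<Rightarrow> 'a \<Rightarrow> real" where
  "nystroem k l Z U lam s x y =
     (\<Sum>i | 1 \<le> i \<and> i \<le> s \<and> 0 < lam i.
        1 / lam i * (\<Sum>j=1..l. U j i * k (Z j) x) * (\<Sum>j=1..l. U j i * k (Z j) y))"

section \<open>Quadrature\<close>

definition quadrature :: "nat \<Rightarrow> (nat \<Rightarrow> real) \<Rightarrow> (nat \<Rightarrow> 'a) \<Rightarrow> ('a \<Rightarrow> real) \<Rightarrow> real" where
  "quadrature n w x f = (\<Sum>i=1..n. w i * f (x i))"

definition convex_weights :: "nat \<Rightarrow> (nat \<Rightarrow> real) \<Rightarrow> bool" where
  "convex_weights n w \<longleftrightarrow> (\<forall>i\<in>{1..n}. 0 \<le> w i) \<and> (\<Sum>i=1..n. w i) = 1"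

text \<open>For a bounded kernel with measurable Mercer expansion, the elements of \<open>H\<close> are measurable and
  the unit ball of \<open>H\<close> is uniformly bounded, so the integrals and the real supremum are proper.\<close>

definition wce ::
    "('a \<Rightarrow> real) set \<Rightarrow> (('a \<Rightarrow> real) \<Rightarrow> ('a \<Rightarrow> real) \<Rightarrow> real) \<Rightarrow> 'a measure \<Rightarrow>
     (('a \<Rightarrow> real) \<Rightarrow> real) \<Rightarrow> real" where
  "wce H ip M Q = (SUP f \<in> {f \<in> H. ip_norm ip f \<le> 1}. \<bar>Q f - (\<integral>x. f x \<partial>M)\<bar>)"

end

theory Submission
  imports Defs
begin

text \<open>Write \<open>\<phi>(x) = k(x, \<cdot>) \<in> H\<close>. The Nystroem residual \<open>k(x,x) - k\<^sub>s\<^sup>Z(x,x)\<close> is \<open>\<parallel>\<phi>(x) - \<Pi> \<phi>(x)\<parallel>\<^sup>2\<close>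
  for the projection \<open>\<Pi>\<close> onto the top \<open>s\<close> principal directions of \<open>\<phi>(z\<^sub>1), \<dots>, \<phi>(z\<^sub>l)\<close>. By optimality
  of principal components (Ky Fan) its empirical mean over \<open>Z\<close> is at most that of \<open>k - k\<^sub>s\<close>, with
  \<open>k\<^sub>s\<close> the truncated Mercer kernel, so the empirical mean of the square root has expectation at most
  \<open>(\<Sum>\<^sub>i\<^sub>>\<^sub>s \<sigma>\<^sub>i)\<^sup>1\<^sup>/\<^sup>2\<close>.

  To pass to the mean over \<open>M\<close>, truncate \<open>\<phi>\<close> to its first \<open>m = O((ln l)\<^sup>d)\<close> Mercer coordinates, at the
  cost of \<open>O(1/l)\<close> by the decay of \<open>\<sigma>\<close>. The truncated functions are square roots of quadratic forms with
  an \<open>m \<times> m\<close> coefficient matrix; rounding its entries leaves a finite class whose cardinality has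
  logarithm \<open>O((ln l)\<^sup>2\<^sup>d\<^sup>+\<^sup>1)\<close>. For functions with values in \<open>[0, K]\<close>, the mean exceeds twice the
  empirical mean by at most \<open>2 K ln N / l\<close> in expectation, uniformly over a class of \<open>N\<close> functions.

  A quadrature rule can be chosen independently of \<open>Z\<close>: a convex combination of \<open>s + 1\<close> point evaluations
  that nearly integrates \<open>e\<^sub>1, \<dots>, e\<^sub>s\<close> and does not overestimate the integral of \<open>(k - k\<^sub>s)\<^sup>1\<^sup>/\<^sup>2\<close> by much
  has worst-case error close to \<open>2 (\<Sum>\<^sub>i\<^sub>>\<^sub>s \<sigma>\<^sub>i)\<^sup>1\<^sup>/\<^sup>2\<close>.\<close>

section \<open>Orthonormal families in function spaces\<close>

context hilbert_function_space
begin

section \<open>Inner-product algebra on a function space\<close>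

lemma diff_mem: "f \<in> H \<Longrightarrow> g \<in> H \<Longrightarrow> (\<lambda>x. f x - g x) \<in> H"
  using add_mem[of f "\<lambda>x. (-1) * g x"] scale_mem[of g "-1"] by simp

lemma sum_mem: "finite J \<Longrightarrow> (\<And>j. j \<in> J \<Longrightarrow> v j \<in> H) \<Longrightarrow> (\<lambda>x. \<Sum>j\<in>J. c j * v j x) \<in> H"
proof (induction J rule: finite_induct)
  case (insert j J)
  then show ?case using add_mem[OF scale_mem[of "v j" "c j"], of "\<lambda>x. \<Sum>j\<in>J. c j * v j x"] by simp
qed (simp add: zero_mem)

lemma ip_zero_left: "h \<in> H \<Longrightarrow> ip (\<lambda>x. 0) h = 0"
  using ip_scale_left[OF zero_mem, of h 0] by simp

lemma ip_diff_left: "f \<in> H \<Longrightarrow> g \<in> H \<Longrightarrow> h \<in> H \<Longrightarrow> ip (\<lambda>x. f x - g x) h = ip f h - ip g h"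
  using ip_add_left[of f "\<lambda>x. (-1) * g x" h] scale_mem[of g "-1"] ip_scale_left[of g h "-1"] by simp

lemma ip_scale_right: "f \<in> H \<Longrightarrow> g \<in> H \<Longrightarrow> ip f (\<lambda>x. c * g x) = c * ip f g"
  using ip_scale_left[of g f c] ip_commute[OF scale_mem, of g f c] ip_commute[of g f] by simp

lemma ip_diff_right: "f \<in> H \<Longrightarrow> g \<in> H \<Longrightarrow> h \<in> H \<Longrightarrow> ip h (\<lambda>x. f x - g x) = ip h f - ip h g"
  using ip_diff_left[of f g h] ip_commute[OF diff_mem, of f g h] ip_commute[of f h] ip_commute[of g h]
  by linarith

lemma ip_sum_left:
  assumes "finite J" "\<And>j. j \<in> J \<Longrightarrow> v j \<in> H" "h \<in> H"
  shows "ip (\<lambda>x. \<Sum>j\<in>J. c j * v j x) h = (\<Sum>j\<in>J. c j * ip (v j) h)"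
  using assms(1,2)
proof (induction J rule: finite_induct)
  case (insert j J)
  have "ip (\<lambda>x. c j * v j x + (\<Sum>j\<in>J. c j * v j x)) h
    = ip (\<lambda>x. c j * v j x) h + ip (\<lambda>x. \<Sum>j\<in>J. c j * v j x) h"
    using insert assms(3) by (intro ip_add_left scale_mem sum_mem) auto
  then show ?case using insert assms(3) ip_scale_left[of "v j" h "c j"] by simp
qed (simp add: ip_zero_left assms)

lemma ip_sum_right:
  assumes "finite J" "\<And>j. j \<in> J \<Longrightarrow> v j \<in> H" "h \<in> H"
  shows "ip h (\<lambda>x. \<Sum>j\<in>J. c j * v j x) = (\<Sum>j\<in>J. c j * ip h (v j))"
proof -
  have "ip h (\<lambda>x. \<Sum>j\<in>J. c j * v j x) = (\<Sum>j\<in>J. c j * ip (v j) h)"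
    using ip_sum_left[OF assms] ip_commute[OF assms(3) sum_mem[OF assms(1,2)]] by simp
  also have "\<dots> = (\<Sum>j\<in>J. c j * ip h (v j))"
    using assms by (intro sum.cong) (auto simp: ip_commute)
  finally show ?thesis .
qed

lemma ip_nonneg: "f \<in> H \<Longrightarrow> 0 \<le> ip f f"
  using ip_pos[of f] ip_zero_left[OF zero_mem] by (cases "f = (\<lambda>x. 0)") auto

lemma ip_eq_0_iff: "f \<in> H \<Longrightarrow> ip f f = 0 \<longleftrightarrow> f = (\<lambda>x. 0)"
  using ip_pos[of f] ip_zero_left[OF zero_mem] by fastforce

lemma ip_norm_nonneg: "f \<in> H \<Longrightarrow> 0 \<le> ip_norm ip f"
  by (simp add: ip_norm_def ip_nonneg)

lemma ip_norm_sq: "f \<in> H \<Longrightarrow> (ip_norm ip f)\<^sup>2 = ip f f"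
  by (simp add: ip_norm_def ip_nonneg)

lemma ip_diff_diff:
  assumes "f \<in> H" "g \<in> H"
  shows "ip (\<lambda>x. f x - g x) (\<lambda>x. f x - g x) = ip f f - 2 * ip f g + ip g g"
  using assms by (simp add: ip_diff_left ip_diff_right diff_mem ip_commute[of g f])

lemma cauchy_schwarz:
  assumes f: "f \<in> H" and g: "g \<in> H"
  shows "\<bar>ip f g\<bar> \<le> ip_norm ip f * ip_norm ip g"
proof -
  have "(ip f g)\<^sup>2 \<le> ip f f * ip g g"
  proof (cases "g = (\<lambda>x. 0)")
    case True
    then show ?thesis using ip_commute[OF f g] ip_zero_left[OF f] ip_zero_left[OF zero_mem] by simp
  next
    case False
    then have gg: "ip g g > 0" using ip_pos g by blast
    define t where "t = ip f g / ip g g"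
    have "0 \<le> ip (\<lambda>x. f x - t * g x) (\<lambda>x. f x - t * g x)"
      by (intro ip_nonneg diff_mem scale_mem f g)
    also have "\<dots> = ip f f - 2 * (t * ip f g) + t * (t * ip g g)"
      using ip_diff_diff[OF f scale_mem[OF g, of t]] ip_scale_right[OF f g, of t]
        ip_scale_left[OF g scale_mem[OF g], of t t] ip_scale_right[OF g g, of t] by simp
    also have "t * (t * ip g g) = t * ip f g" using gg by (simp add: t_def)
    finally have "t * ip f g \<le> ip f f" by simp
    then show ?thesis using gg by (simp add: t_def field_simps power2_eq_square)
  qed
  then have "sqrt ((ip f g)\<^sup>2) \<le> sqrt (ip f f * ip g g)" by (rule real_sqrt_le_mono)
  then show ?thesis by (simp add: ip_norm_def real_sqrt_mult)
qed

lemma ip_norm_diff_commute: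
  assumes "f \<in> H" "g \<in> H"
  shows "ip_norm ip (\<lambda>x. f x - g x) = ip_norm ip (\<lambda>x. g x - f x)"
  using assms by (simp add: ip_norm_def ip_diff_diff ip_commute[of g f])

lemma ip_norm_triangle:
  assumes f: "f \<in> H" and g: "g \<in> H"
  shows "ip_norm ip f \<le> ip_norm ip g + ip_norm ip (\<lambda>x. f x - g x)"
proof -
  have "ip f g \<le> ip_norm ip f * ip_norm ip g" using cauchy_schwarz[OF f g] by simp
  then have "(ip_norm ip f - ip_norm ip g)\<^sup>2 \<le> (ip_norm ip (\<lambda>x. f x - g x))\<^sup>2"
    using f g by (simp add: power2_diff ip_norm_sq diff_mem ip_diff_diff)
  then have "ip_norm ip f - ip_norm ip g \<le> ip_norm ip (\<lambda>x. f x - g x)"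
    by (rule power2_le_imp_le) (intro ip_norm_nonneg diff_mem f g)
  then show ?thesis by simp
qed

section \<open>Finite orthonormal systems, projections and residuals\<close>

definition orthonormal_on :: "'i set \<Rightarrow> ('i \<Rightarrow> 'a \<Rightarrow> real) \<Rightarrow> bool" where
  "orthonormal_on J v \<longleftrightarrow>
     (\<forall>j\<in>J. v j \<in> H) \<and> (\<forall>i\<in>J. \<forall>j\<in>J. ip (v i) (v j) = (if i = j then 1 else 0))"

definition proj :: "'i set \<Rightarrow> ('i \<Rightarrow> 'a \<Rightarrow> real) \<Rightarrow> ('a \<Rightarrow> real) \<Rightarrow> 'a \<Rightarrow> real" where
  "proj J v h x = (\<Sum>j\<in>J. ip h (v j) * v j x)"

definition resid :: "'i set \<Rightarrow> ('i \<Rightarrow> 'a \<Rightarrow> real) \<Rightarrow> ('a \<Rightarrow> real) \<Rightarrow> 'a \<Rightarrow> real" where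
  "resid J v h x = h x - proj J v h x"

lemma proj_mem: "finite J \<Longrightarrow> orthonormal_on J v \<Longrightarrow> proj J v h \<in> H"
  unfolding proj_def[abs_def] by (rule sum_mem) (auto simp: orthonormal_on_def)

lemma resid_mem: "finite J \<Longrightarrow> orthonormal_on J v \<Longrightarrow> h \<in> H \<Longrightarrow> resid J v h \<in> H"
  unfolding resid_def[abs_def] by (intro diff_mem proj_mem)

lemma ip_proj_right:
  assumes "finite J" "orthonormal_on J v" "h \<in> H"
  shows "ip h (proj J v g) = (\<Sum>j\<in>J. ip g (v j) * ip h (v j))"
  unfolding proj_def[abs_def] using assms by (intro ip_sum_right) (auto simp: orthonormal_on_def)

lemma ip_proj_basis:
  assumes "finite J" "orthonormal_on J v" "i \<in> J"
  shows "ip (proj J v h) (v i) = ip h (v i)"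
proof -
  have "ip (proj J v h) (v i) = (\<Sum>j\<in>J. ip h (v j) * ip (v j) (v i))"
    unfolding proj_def[abs_def] using assms by (intro ip_sum_left) (auto simp: orthonormal_on_def)
  also have "\<dots> = (\<Sum>j\<in>J. if j = i then ip h (v i) else 0)"
    using assms by (intro sum.cong) (auto simp: orthonormal_on_def)
  finally show ?thesis using assms by simp
qed

text \<open>The projection is self-adjoint and idempotent, so the three products that involve it
  share the value \<open>S\<close> and one copy survives. Bessel's inequality, the contraction
  property of residuals and the Nystroem residual formula are read off from this identity.\<close>

lemma ip_resid_resid:
  assumes fin: "finite J" and on: "orthonormal_on J v" and h: "h \<in> H" and g: "g \<in> H"
  shows "ip (resid J v h) (resid J v g) = ip h g - (\<Sum>j\<in>J. ip h (v j) * ip g (v j))"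
proof -
  define S where "S = (\<Sum>j\<in>J. ip h (v j) * ip g (v j))"
  have P: "proj J v h \<in> H" "proj J v g \<in> H" by (intro proj_mem[OF fin on])+
  have 1: "ip (proj J v h) (proj J v g) = S"
    using ip_proj_right[OF fin on P(1), of g] fin on by (simp add: ip_proj_basis S_def mult.commute)
  have 2: "ip h (proj J v g) = S"
    using ip_proj_right[OF fin on h, of g] by (simp add: S_def mult.commute)
  have 3: "ip (proj J v h) g = S"
    using ip_proj_right[OF fin on g, of h] ip_commute[OF P(1) g] by (simp add: S_def)
  have "ip (resid J v h) (resid J v g) = ip h g - S - (S - S)"
    unfolding resid_def[abs_def]
    by (simp only: ip_diff_left[OF h P(1) diff_mem[OF g P(2)]] ip_diff_right[OF g P(2) h]
        ip_diff_right[OF g P(2) P(1)] 1 2 3)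
  then show ?thesis by (simp add: S_def)
qed

lemma bessel:
  assumes "finite J" "orthonormal_on J v" "h \<in> H"
  shows "(\<Sum>j\<in>J. (ip h (v j))\<^sup>2) \<le> ip h h"
  using ip_resid_resid[OF assms assms(3)] ip_nonneg[OF resid_mem[OF assms]]
  by (simp add: power2_eq_square)

lemma resid_norm_le:
  assumes "finite J" "orthonormal_on J v" "h \<in> H"
  shows "ip_norm ip (resid J v h) \<le> ip_norm ip h"
  unfolding ip_norm_def using ip_resid_resid[OF assms assms(3)]
  by (intro real_sqrt_le_mono) (simp add: sum_nonneg)

text \<open>Linearity of the residual map; with \<open>resid_norm_le\<close> it makes residual norms
  1-Lipschitz, which allows \<open>k x\<close> to be replaced by its truncation.\<close>

lemma resid_diff:
  assumes "finite J" "orthonormal_on J v" "h \<in> H" "g \<in> H"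
  shows "resid J v (\<lambda>x. h x - g x) = (\<lambda>x. resid J v h x - resid J v g x)"
  using assms by (auto simp: resid_def proj_def orthonormal_on_def fun_eq_iff ip_diff_left
      left_diff_distrib sum_subtractf)

text \<open>Ky Fan's inequality; the left-hand side is the trace of the compression of
  \<open>\<Sum>\<^sub>r lam r v\<^sub>r \<otimes> v\<^sub>r\<close> to the span of the \<open>b\<^sub>j\<close>.\<close>

lemma ky_fan:
  fixes v :: "nat \<Rightarrow> 'a \<Rightarrow> real" and lam :: "nat \<Rightarrow> real"
  assumes J: "finite J" "orthonormal_on J b" "card J \<le> s"
    and I: "I \<subseteq> {1..l}" "orthonormal_on I v"
    and zero: "\<And>r. r \<in> {1..l} - I \<Longrightarrow> lam r = 0"
    and dec: "\<And>i j. 1 \<le> i \<Longrightarrow> i \<le> j \<Longrightarrow> j \<le> l \<Longrightarrow> lam j \<le> lam i"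
    and nonneg: "\<And>r. 1 \<le> r \<Longrightarrow> r \<le> l \<Longrightarrow> 0 \<le> lam r"
    and s: "1 \<le> s" "s \<le> l"
  shows "(\<Sum>j\<in>J. \<Sum>r\<in>I. lam r * (ip (b j) (v r))\<^sup>2) \<le> (\<Sum>r=1..s. lam r)"
proof -
  \<comment> \<open>\<open>c r\<close> is the squared length of the projection of \<open>v r\<close>
    onto the span of the \<open>b j\<close>. Bessel's inequality for \<open>b\<close> gives
    \<open>c r \<le> 1\<close>, and for \<open>v\<close> it gives total mass at most
    \<open>s\<close>; what remains is a linear program in \<open>c\<close>. The value 0 off
    \<open>I\<close> lets sums run over \<open>1..l\<close>.\<close>
  define c where "c r = (if r \<in> I then \<Sum>j\<in>J. (ip (b j) (v r))\<^sup>2 else 0)" for r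
  have finI: "finite I" using I(1) finite_subset by blast
  have bH: "b j \<in> H" if "j \<in> J" for j using J(2) that by (auto simp: orthonormal_on_def)
  have vH: "v r \<in> H" if "r \<in> I" for r using I(2) that by (auto simp: orthonormal_on_def)
  have c0: "0 \<le> c r" for r by (simp add: c_def sum_nonneg)
  have c1: "c r \<le> 1" for r
  proof (cases "r \<in> I")
    case True
    have "(\<Sum>j\<in>J. (ip (b j) (v r))\<^sup>2) = (\<Sum>j\<in>J. (ip (v r) (b j))\<^sup>2)"
      using bH vH True by (intro sum.cong) (auto simp: ip_commute)
    also have "\<dots> \<le> ip (v r) (v r)" by (rule bessel[OF J(1,2) vH[OF True]])
    also have "\<dots> = 1" using I(2) True by (auto simp: orthonormal_on_def)
    finally show ?thesis using True by (simp add: c_def)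
  qed (simp add: c_def)
  have csum: "(\<Sum>r=1..l. c r) \<le> s"
  proof -
    have "(\<Sum>r=1..l. c r) = (\<Sum>r\<in>I. c r)"
      using I(1) by (intro sum.mono_neutral_right) (auto simp: c_def)
    also have "\<dots> = (\<Sum>r\<in>I. \<Sum>j\<in>J. (ip (b j) (v r))\<^sup>2)"
      by (intro sum.cong) (auto simp: c_def)
    also have "\<dots> = (\<Sum>j\<in>J. \<Sum>r\<in>I. (ip (b j) (v r))\<^sup>2)" by (rule sum.swap)
    also have "\<dots> \<le> (\<Sum>j\<in>J. 1)"
    proof (rule sum_mono)
      fix j assume j: "j \<in> J"
      have "(\<Sum>r\<in>I. (ip (b j) (v r))\<^sup>2) \<le> ip (b j) (b j)" by (rule bessel[OF finI I(2) bH[OF j]])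
      also have "\<dots> = 1" using J(2) j by (auto simp: orthonormal_on_def)
      finally show "(\<Sum>r\<in>I. (ip (b j) (v r))\<^sup>2) \<le> 1" .
    qed
    finally show ?thesis using J(3) by simp
  qed
  have split: "(\<Sum>r=1..l. g r) = (\<Sum>r=1..s. g r) + (\<Sum>r=Suc s..l. g r)" for g :: "nat \<Rightarrow> real"
  proof -
    have "{1..l} = {1..s} \<union> {Suc s..l}" using s by auto
    then show ?thesis by (simp add: sum.union_disjoint)
  qed
  have "(\<Sum>j\<in>J. \<Sum>r\<in>I. lam r * (ip (b j) (v r))\<^sup>2) = (\<Sum>r\<in>I. lam r * c r)"
    unfolding sum.swap[of _ I J] by (intro sum.cong) (auto simp: c_def sum_distrib_left)
  also have "\<dots> = (\<Sum>r=1..l. lam r * c r)"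
    using I(1) zero by (intro sum.mono_neutral_left) auto
  also have "\<dots> = (\<Sum>r=1..s. lam r * c r) + (\<Sum>r=Suc s..l. lam r * c r)" by (rule split)
  \<comment> \<open>Mass beyond \<open>s\<close> is worth at most \<open>lam s\<close> per unit and
    fits into the free capacity \<open>1 - c r\<close> of the first \<open>s\<close> indices, where
    a unit is worth at least \<open>lam s\<close>.\<close>
  also have "(\<Sum>r=Suc s..l. lam r * c r) \<le> (\<Sum>r=Suc s..l. lam s * c r)"
    using s dec c0 by (intro sum_mono mult_right_mono) auto
  also have "\<dots> = lam s * (\<Sum>r=Suc s..l. c r)" by (simp add: sum_distrib_left)
  also have "\<dots> \<le> lam s * (s - (\<Sum>r=1..s. c r))"
    using csum split[of c] s nonneg by (intro mult_left_mono) auto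
  also have "\<dots> = (\<Sum>r=1..s. lam s * (1 - c r))"
    by (simp add: sum_distrib_left[symmetric] sum_subtractf)
  also have "(\<Sum>r=1..s. lam r * c r) + (\<Sum>r=1..s. lam s * (1 - c r)) \<le> (\<Sum>r=1..s. lam r)"
    unfolding sum.distrib[symmetric]
  proof (rule sum_mono)
    fix r assume "r \<in> {1..s}"
    then have "lam s * (1 - c r) \<le> lam r * (1 - c r)"
      using dec s c1 by (intro mult_right_mono) auto
    then show "lam r * c r + lam s * (1 - c r) \<le> lam r" by (simp add: algebra_simps)
  qed
  finally show ?thesis by simp
qed

end

section \<open>Multiplicative deviation inequality\<close>

context prob_space
begin

text \<open>A linear upper bound for \<open>exp (- u)\<close> on \<open>[0, 1]\<close> requires only
  the first moment of \<open>f\<close>. Its slope of size 1/2 is the source of the factor two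
  between mean and empirical mean.\<close>

lemma expectation_exp_neg_le:
  fixes f :: "'a \<Rightarrow> real"
  assumes f[measurable]: "f \<in> borel_measurable M" and bnd: "\<And>x. 0 \<le> f x" "\<And>x. f x \<le> K" and K: "0 < K"
  shows "integral\<^sup>L M (\<lambda>x. exp (- f x / K)) \<le> exp (- integral\<^sup>L M f / (2 * K))"
proof -
  have int: "integrable M f"
    using bnd by (intro integrable_const_bound[of _ K]) (auto intro!: AE_I2)
  have ptw: "exp (- f x / K) \<le> 1 - f x / (2 * K)" for x
  proof -
    define u where "u = f x / K"
    have u: "0 \<le> u" "u \<le> 1" using bnd[of x] K by (auto simp: u_def)
    \<comment> \<open>The product equals \<open>1 + (u - u^2) / 2\<close>, and
      \<open>u^2 \<le> u\<close>.\<close>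
    have "1 * 1 \<le> (1 + u) * (1 - u / 2)"
      using u mult_left_le[of u u] by (simp add: field_simps)
    also have "\<dots> \<le> exp u * (1 - u / 2)"
      using u exp_ge_add_one_self[of u] by (intro mult_right_mono) auto
    finally have "exp (- u) \<le> 1 - u / 2" by (simp add: exp_minus field_simps)
    then show ?thesis by (simp add: u_def)
  qed
  have "integral\<^sup>L M (\<lambda>x. exp (- f x / K)) \<le> integral\<^sup>L M (\<lambda>x. 1 - f x / (2 * K))"
    using int bnd K ptw
    by (intro integral_mono integrable_const_bound[of "\<lambda>x. exp (- f x / K)" 1]) (auto intro!: AE_I2)
  also have "\<dots> = 1 - integral\<^sup>L M f / (2 * K)" using int by (simp add: prob_space)
  also have "\<dots> \<le> exp (- integral\<^sup>L M f / (2 * K))"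
    using exp_ge_add_one_self[of "- integral\<^sup>L M f / (2 * K)"] by simp
  finally show ?thesis .
qed

lemma prob_space_PiM_const: "prob_space (PiM I (\<lambda>_. M))"
  by (intro prob_space_PiM) unfold_locales

lemma integral_PiM_coordinate:
  fixes f :: "'a \<Rightarrow> real"
  assumes "j \<in> I" and f: "f \<in> borel_measurable M"
  shows "(\<integral>Z. f (Z j) \<partial>PiM I (\<lambda>_. M)) = integral\<^sup>L M f"
    and "integrable M f \<Longrightarrow> integrable (PiM I (\<lambda>_. M)) (\<lambda>Z. f (Z j))"
proof -
  interpret product_prob_space "\<lambda>_. M" I by unfold_locales
  have D: "distr (PiM I (\<lambda>_. M)) M (\<lambda>Z. Z j) = M" by (rule PiM_component[OF assms(1)])
  have m: "(\<lambda>Z. Z j) \<in> measurable (PiM I (\<lambda>_. M)) M" using assms(1) by simp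
  show "(\<integral>Z. f (Z j) \<partial>PiM I (\<lambda>_. M)) = integral\<^sup>L M f"
    using integral_distr[OF m f] D by simp
  show "integrable M f \<Longrightarrow> integrable (PiM I (\<lambda>_. M)) (\<lambda>Z. f (Z j))"
    using integrable_distr[OF m, of f] D by simp
qed

text \<open>Independence factorizes the exponential moment; the prefactor \<open>a\<close> cancels
  the \<open>l\<close> single-coordinate bounds exactly.\<close>

lemma exp_deviation:
  fixes l :: nat and f :: "'a \<Rightarrow> real"
  defines "P \<equiv> PiM {1..l} (\<lambda>_. M)"
  assumes f[measurable]: "f \<in> borel_measurable M" and bnd: "\<And>x. 0 \<le> f x" "\<And>x. f x \<le> K" and K: "0 < K"
  shows "integrable P (\<lambda>Z. exp ((l * integral\<^sup>L M f / 2 - (\<Sum>j=1..l. f (Z j))) / K))" (is ?I)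
    and "(\<integral>Z. exp ((l * integral\<^sup>L M f / 2 - (\<Sum>j=1..l. f (Z j))) / K) \<partial>P) \<le> 1" (is ?E)
proof -
  have int: "integrable M (\<lambda>x. exp (- f x / K))"
    using bnd K by (intro integrable_const_bound[of _ 1]) (auto intro!: AE_I2)
  note single = expectation_exp_neg_le[OF f bnd K]
  interpret product_prob_space "\<lambda>_. M" "{1..l}" by unfold_locales
  define a where "a = exp (l * integral\<^sup>L M f / 2 / K)"
  have eq: "exp ((l * integral\<^sup>L M f / 2 - (\<Sum>j=1..l. f (Z j))) / K) = a * (\<Prod>j=1..l. exp (- f (Z j) / K))" for Z
  proof -
    have "(\<Prod>j=1..l. exp (- f (Z j) / K)) = exp (\<Sum>j=1..l. - f (Z j) / K)" by (simp add: exp_sum)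
    also have "(\<Sum>j=1..l. - f (Z j) / K) = - (\<Sum>j=1..l. f (Z j)) / K"
      by (simp add: sum_divide_distrib sum_negf)
    finally show ?thesis by (simp only: a_def exp_add[symmetric]) (simp add: diff_divide_distrib)
  qed
  have int': "integrable P (\<lambda>Z. \<Prod>j=1..l. exp (- f (Z j) / K))"
    unfolding P_def by (rule product_integrable_prod) (use int in auto)
  then show ?I unfolding eq by simp
  have "(\<integral>Z. (\<Prod>j=1..l. exp (- f (Z j) / K)) \<partial>P) = (\<Prod>j=1..l. integral\<^sup>L M (\<lambda>x. exp (- f x / K)))"
    unfolding P_def by (rule product_integral_prod) (use int in auto)
  also have "\<dots> \<le> (\<Prod>j=1..l. exp (- integral\<^sup>L M f / (2 * K)))"
    by (intro prod_mono conjI single integral_nonneg_AE) auto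
  also have "\<dots> = exp (real l * (- integral\<^sup>L M f / (2 * K)))"
    by (subst exp_of_nat_mult) simp
  also have "real l * (- integral\<^sup>L M f / (2 * K)) = - (l * integral\<^sup>L M f / 2 / K)" by simp
  also have "exp \<dots> = 1 / a" by (simp only: a_def exp_minus inverse_eq_divide)
  finally have "a * (\<integral>Z. (\<Prod>j=1..l. exp (- f (Z j) / K)) \<partial>P) \<le> a * (1 / a)"
    by (intro mult_left_mono) (auto simp: a_def)
  then show ?E unfolding eq using int' by (simp add: a_def)
qed

text \<open>An exponential union bound. \<open>D\<close> is an explicit finite sum rather than a
  supremum over \<open>T\<close>, so its integrability is immediate, and the pointwise inequality
  covers an index \<open>a\<close> chosen in dependence on \<open>Z\<close>.\<close>

lemma uniform_deviation:
  fixes l :: nat and g :: "'i \<Rightarrow> 'a \<Rightarrow> real"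
  defines "P \<equiv> PiM {1..l} (\<lambda>_. M)"
  assumes T: "finite T" "T \<noteq> {}"
    and g[measurable]: "\<And>a. a \<in> T \<Longrightarrow> g a \<in> borel_measurable M"
    and bnd: "\<And>a x. a \<in> T \<Longrightarrow> 0 \<le> g a x" "\<And>a x. a \<in> T \<Longrightarrow> g a x \<le> K"
    and K: "0 < K" and l: "0 < l"
  obtains D where "integrable P D" "(\<integral>Z. D Z \<partial>P) \<le> 2 * K * ln (card T) / l"
    "\<And>a Z. a \<in> T \<Longrightarrow> integral\<^sup>L M (g a) \<le> 2 / l * (\<Sum>j=1..l. g a (Z j)) + D Z"
proof -
  interpret P: prob_space P unfolding P_def by (rule prob_space_PiM_const)
  define N where "N = real (card T)"
  have N: "0 < N" using T by (simp add: N_def card_gt_0_iff)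
  define X where "X a Z = (l * integral\<^sup>L M (g a) / 2 - (\<Sum>j=1..l. g a (Z j))) / K" for a Z
  have X: "integrable P (\<lambda>Z. exp (X a Z))" "(\<integral>Z. exp (X a Z) \<partial>P) \<le> 1" if "a \<in> T" for a
    unfolding X_def P_def by (intro exp_deviation g that bnd K)+
  \<comment> \<open>The tangent of the logarithm at \<open>N\<close> gives
    \<open>x \<le> ln N - 1 + exp x / N\<close>; it is applied to each \<open>X a Z\<close>, and the
    exponential is then enlarged to the sum over \<open>T\<close>. As every exponential has mean at
    most 1, the mean of the bracket is at most \<open>ln N\<close>.\<close>
  define D where "D Z = 2 * K / l * (ln N - 1 + 1 / N * (\<Sum>a\<in>T. exp (X a Z)))" for Z
  have intS: "integrable P (\<lambda>Z. \<Sum>a\<in>T. exp (X a Z))" using X by auto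
  show ?thesis
  proof
    show "integrable P D" unfolding D_def using intS by simp
    have "(\<integral>Z. D Z \<partial>P) = 2 * K / l * (ln N - 1 + 1 / N * (\<Sum>a\<in>T. \<integral>Z. exp (X a Z) \<partial>P))"
      unfolding D_def using intS X by (simp add: P.prob_space)
    also have "\<dots> \<le> 2 * K / l * (ln N - 1 + 1 / N * (\<Sum>a\<in>T. 1))"
      using X K N by (intro mult_left_mono add_left_mono sum_mono) auto
    also have "\<dots> = 2 * K * ln (card T) / l" using N by (simp add: N_def)
    finally show "(\<integral>Z. D Z \<partial>P) \<le> 2 * K * ln (card T) / l" .
    fix a Z assume a: "a \<in> T"
    have "X a Z - ln N \<le> exp (X a Z - ln N) - 1" using exp_ge_add_one_self[of "X a Z - ln N"] by linarith
    also have "exp (X a Z - ln N) = 1 / N * exp (X a Z)" using N by (simp add: exp_diff)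
    also have "\<dots> \<le> 1 / N * (\<Sum>a\<in>T. exp (X a Z))"
      using N a T by (intro mult_left_mono member_le_sum) auto
    finally have "2 * K / l * X a Z \<le> D Z"
      unfolding D_def using K l by (intro mult_left_mono) auto
    moreover have "2 * K / l * X a Z = integral\<^sup>L M (g a) - 2 / l * (\<Sum>j=1..l. g a (Z j))"
      using K l by (simp add: X_def field_simps)
    ultimately show "integral\<^sup>L M (g a) \<le> 2 / l * (\<Sum>j=1..l. g a (Z j)) + D Z" by linarith
  qed
qed

text \<open>Jensen's inequality for the square root, obtained from the nonnegative variance of the
  root.\<close>

lemma expectation_sqrt_mean_le:
  fixes l :: nat and f :: "'a \<Rightarrow> real"
  defines "P \<equiv> PiM {1..l} (\<lambda>_. M)"
  assumes f: "integrable M f" and nonneg: "\<And>x. 0 \<le> f x" and l: "0 < l"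
  shows "integrable P (\<lambda>Z. sqrt ((\<Sum>j=1..l. f (Z j)) / l))"
    and "(\<integral>Z. sqrt ((\<Sum>j=1..l. f (Z j)) / l) \<partial>P) \<le> sqrt (integral\<^sup>L M f)"
proof -
  interpret P: prob_space P unfolding P_def by (rule prob_space_PiM_const)
  define S where "S Z = (\<Sum>j=1..l. f (Z j)) / l" for Z
  have S0: "0 \<le> S Z" for Z by (simp add: S_def sum_nonneg nonneg)
  have fm: "f \<in> borel_measurable M" using f by simp
  have c: "integrable P (\<lambda>Z. f (Z j))" "(\<integral>Z. f (Z j) \<partial>P) = integral\<^sup>L M f" if "j \<in> {1..l}" for j
    unfolding P_def using integral_PiM_coordinate[OF that fm] f by auto
  have S: "integrable P S" unfolding S_def[abs_def]
    by (intro integrable_divide_zero Bochner_Integration.integrable_sum) (auto intro: c)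
  have ES: "(\<integral>Z. S Z \<partial>P) = integral\<^sup>L M f"
    unfolding S_def using c l by simp
  \<comment> \<open>An integrable dominating function for the root; \<open>f\<close> is not assumed
    bounded.\<close>
  have le: "sqrt (S Z) \<le> 1 + S Z" for Z
  proof -
    have "0 \<le> (sqrt (S Z) - 1)\<^sup>2" by simp
    then show ?thesis using S0[of Z] real_sqrt_ge_zero[OF S0[of Z]] by (simp add: power2_diff)
  qed
  have Sm: "S \<in> borel_measurable P" using S by simp
  have int: "integrable P (\<lambda>Z. sqrt (S Z))"
  proof (rule Bochner_Integration.integrable_bound)
    show "integrable P (\<lambda>Z. 1 + S Z)" using S by simp
    show "(\<lambda>Z. sqrt (S Z)) \<in> borel_measurable P" using Sm by simp
    show "AE Z in P. norm (sqrt (S Z)) \<le> norm (1 + S Z)" using le S0 by (auto intro!: AE_I2 simp: abs_of_nonneg)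
  qed
  then show "integrable P (\<lambda>Z. sqrt ((\<Sum>j=1..l. f (Z j)) / l))" by (simp add: S_def)
  have "0 \<le> P.variance (\<lambda>Z. sqrt (S Z))" by (rule P.variance_positive)
  also have "\<dots> = (\<integral>Z. S Z \<partial>P) - (\<integral>Z. sqrt (S Z) \<partial>P)\<^sup>2"
    using P.variance_eq[OF int] S S0 by simp
  finally have "(\<integral>Z. sqrt (S Z) \<partial>P)\<^sup>2 \<le> integral\<^sup>L M f" using ES by simp
  then show "(\<integral>Z. sqrt ((\<Sum>j=1..l. f (Z j)) / l) \<partial>P) \<le> sqrt (integral\<^sup>L M f)"
    by (simp add: S_def real_le_rsqrt)
qed

end

section \<open>Convex quadrature with few nodes\<close>

text \<open>Gaussian elimination, one equation per induction step. The unknowns are indexed by a set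
  so that they can be the support points of a quadrature rule.\<close>

lemma homogeneous_system_nontrivial:
  fixes a :: "'i \<Rightarrow> 'x \<Rightarrow> real"
  assumes "finite I" "finite S" "card I < card S"
  shows "\<exists>v. (\<exists>x\<in>S. v x \<noteq> 0) \<and> (\<forall>i\<in>I. (\<Sum>x\<in>S. a i x * v x) = 0)"
  using assms
proof (induction I arbitrary: S a rule: finite_induct)
  case empty
  then have "S \<noteq> {}" by auto
  then show ?case by (intro exI[of _ "\<lambda>_. 1"]) auto
next
  case (insert i I)
  show ?case
  proof (cases "\<forall>x\<in>S. a i x = 0")
    case True
    obtain v where "\<exists>x\<in>S. v x \<noteq> 0" "\<forall>i\<in>I. (\<Sum>x\<in>S. a i x * v x) = 0"
      using insert.IH[of S a] insert.prems insert.hyps by auto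
    then show ?thesis using True by (intro exI[of _ v]) auto
  next
    case False
    then obtain y where y: "y \<in> S" "a i y \<noteq> 0" by blast
    define S' where "S' = S - {y}"
    have fS': "finite S'" and S: "S = insert y S'" "y \<notin> S'"
      using y insert.prems by (auto simp: S'_def)
    \<comment> \<open>Row \<open>j\<close> after the unknown \<open>y\<close> has been eliminated
      with equation \<open>i\<close>; \<open>w\<close> below is the back substitution that restores
      equation \<open>i\<close>.\<close>
    define a' where "a' j x = a j x - a j y * a i x / a i y" for j x
    have "card I < card S'"
      using insert.prems insert.hyps S fS' by simp
    then obtain v where v: "\<exists>x\<in>S'. v x \<noteq> 0" "\<forall>j\<in>I. (\<Sum>x\<in>S'. a' j x * v x) = 0"
      using insert.IH[of S' a'] fS' by blast
    define t where "t = (\<Sum>x\<in>S'. a i x * v x)"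
    define w where "w = v(y := - t / a i y)"
    have w: "(\<Sum>x\<in>S. a j x * w x) = (\<Sum>x\<in>S'. a j x * v x) - a j y * t / a i y" for j
    proof -
      have "(\<Sum>x\<in>S'. a j x * w x) = (\<Sum>x\<in>S'. a j x * v x)"
        using S(2) by (intro sum.cong) (auto simp: w_def)
      then show ?thesis unfolding S(1) using S(2) fS' by (simp add: w_def)
    qed
    have "(\<Sum>x\<in>S. a j x * w x) = 0" if "j \<in> insert i I" for j
    proof (cases "j = i")
      case True
      then show ?thesis using w[of i] y by (simp add: t_def)
    next
      case False
      then have "0 = (\<Sum>x\<in>S'. a' j x * v x)" using v(2) that by simp
      also have "\<dots> = (\<Sum>x\<in>S'. a j x * v x - a j y / a i y * (a i x * v x))"
        by (intro sum.cong) (auto simp: a'_def algebra_simps)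
      also have "\<dots> = (\<Sum>x\<in>S'. a j x * v x) - a j y / a i y * t"
        by (simp add: sum_subtractf sum_distrib_left t_def)
      finally show ?thesis using w[of j] by simp
    qed
    moreover have "\<exists>x\<in>S. w x \<noteq> 0" using v(1) S by (auto simp: w_def)
    ultimately show ?thesis by blast
  qed
qed

text \<open>Moving along a kernel direction of the constraints, oriented so that \<open>g\<close> does not increase,
  removes one support point at a time.\<close>

lemma caratheodory_reduction:
  fixes \<phi> :: "'i \<Rightarrow> 'x \<Rightarrow> real" and g w :: "'x \<Rightarrow> real"
  assumes "finite I" "finite S" "\<And>x. x \<in> S \<Longrightarrow> 0 < w x"
  shows "\<exists>S' w'. S' \<subseteq> S \<and> card S' \<le> card I + 1 \<and> (\<forall>x\<in>S'. 0 < w' x) \<and>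
    (\<Sum>x\<in>S'. w' x) = (\<Sum>x\<in>S. w x) \<and>
    (\<forall>i\<in>I. (\<Sum>x\<in>S'. w' x * \<phi> i x) = (\<Sum>x\<in>S. w x * \<phi> i x)) \<and>
    (\<Sum>x\<in>S'. w' x * g x) \<le> (\<Sum>x\<in>S. w x * g x)"
  using assms(2,3)
proof (induction "card S" arbitrary: S w rule: less_induct)
  case less
  show ?case
  proof (cases "card S \<le> card I + 1")
    case True
    then show ?thesis using less.prems by (intro exI[of _ S] exI[of _ w]) auto
  next
    case False
    \<comment> \<open>\<open>None\<close> encodes conservation of total mass and
      \<open>Some j\<close> the moment of \<open>\<phi> j\<close>, which makes
      \<open>card I + 1\<close> linear constraints.\<close>
    define a where "a i x = (case i of None \<Rightarrow> 1 | Some j \<Rightarrow> \<phi> j x)" for i x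
    have "card (insert None (Some ` I)) < card S"
      using False assms(1) by (simp add: card_image)
    then obtain u where u: "\<exists>x\<in>S. u x \<noteq> 0"
      "\<forall>i\<in>insert None (Some ` I). (\<Sum>x\<in>S. a i x * u x) = 0"
      using homogeneous_system_nontrivial[of "insert None (Some ` I)" S a] assms(1) less.prems(1) by auto
    define v where "v x = (if (\<Sum>x\<in>S. u x * g x) \<le> 0 then u x else - u x)" for x
    have v0: "\<exists>x\<in>S. v x \<noteq> 0" using u(1) by (auto simp: v_def)
    have vs: "(\<Sum>x\<in>S. v x) = 0"
      using u(2) by (cases "(\<Sum>x\<in>S. u x * g x) \<le> 0") (auto simp: v_def a_def sum_negf)
    have v\<phi>: "(\<Sum>x\<in>S. v x * \<phi> i x) = 0" if "i \<in> I" for i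
      using u(2) that by (cases "(\<Sum>x\<in>S. u x * g x) \<le> 0") (auto simp: v_def a_def sum_negf mult.commute)
    have vg: "(\<Sum>x\<in>S. v x * g x) \<le> 0"
      by (cases "(\<Sum>x\<in>S. u x * g x) \<le> 0") (auto simp: v_def sum_negf)
    define N where "N = {x\<in>S. v x < 0}"
    have fN: "finite N" using less.prems(1) by (simp add: N_def)
    \<comment> \<open>A nonzero direction of total mass zero has a negative entry, so moving along
      it reaches the boundary of the nonnegative weights.\<close>
    have "N \<noteq> {}"
    proof
      assume "N = {}"
      then have "\<forall>x\<in>S. 0 \<le> v x" by (auto simp: N_def not_less)
      then have "\<forall>x\<in>S. v x = 0" using vs less.prems(1) sum_nonneg_eq_0_iff[of S v] by auto
      then show False using v0 by auto
    qed
    then obtain y where y: "y \<in> N" "\<And>x. x \<in> N \<Longrightarrow> w y / - v y \<le> w x / - v x"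
      using ex_min_if_finite[of "(\<lambda>x. w x / - v x) ` N"] fN by (force simp: not_less)
    \<comment> \<open>The largest step that keeps all weights nonnegative; the minimizer
      \<open>y\<close> of the ratio loses its weight.\<close>
    define t where "t = w y / - v y"
    have yS: "y \<in> S" "v y < 0" using y by (auto simp: N_def)
    have t: "0 < t" using less.prems(2)[OF yS(1)] yS(2) by (simp add: t_def divide_pos_neg)
    define z where "z x = w x + t * v x" for x
    have z0: "0 \<le> z x" if "x \<in> S" for x
    proof (cases "v x < 0")
      case True
      then have "t \<le> w x / - v x" using y that by (auto simp: N_def t_def)
      then have "t * (- v x) \<le> w x" using True by (subst (asm) pos_le_divide_eq) auto
      then show ?thesis by (simp add: z_def)
    next
      case False
      then show ?thesis using t less.prems(2)[OF that] by (simp add: z_def)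
    qed
    have zy: "z y = 0" using yS by (simp add: z_def t_def)
    define T where "T = {x\<in>S. 0 < z x}"
    have "y \<notin> T" "T \<subseteq> S" using zy by (auto simp: T_def)
    then have T: "finite T" "T \<subset> S" using less.prems(1) yS(1) finite_subset by blast+
    have sumT: "(\<Sum>x\<in>T. z x * f x) = (\<Sum>x\<in>S. w x * f x) + t * (\<Sum>x\<in>S. v x * f x)" for f
    proof -
      have "(\<Sum>x\<in>T. z x * f x) = (\<Sum>x\<in>S. z x * f x)"
        using less.prems(1) z0 by (intro sum.mono_neutral_left) (force simp: T_def)+
      then show ?thesis by (simp add: z_def distrib_right sum.distrib sum_distrib_left mult.assoc)
    qed
    have cT: "card T < card S" using T less.prems(1) by (simp add: psubset_card_mono)
    have zT: "0 < z x" if "x \<in> T" for x using that by (simp add: T_def)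
    have "\<exists>S' w'. S' \<subseteq> T \<and> card S' \<le> card I + 1 \<and> (\<forall>x\<in>S'. 0 < w' x) \<and>
      (\<Sum>x\<in>S'. w' x) = (\<Sum>x\<in>T. z x) \<and>
      (\<forall>i\<in>I. (\<Sum>x\<in>S'. w' x * \<phi> i x) = (\<Sum>x\<in>T. z x * \<phi> i x)) \<and>
      (\<Sum>x\<in>S'. w' x * g x) \<le> (\<Sum>x\<in>T. z x * g x)"
      by (rule less.hyps[OF cT T(1) zT])
    then obtain S' w' where IH: "S' \<subseteq> T" "card S' \<le> card I + 1" "\<forall>x\<in>S'. 0 < w' x"
      "(\<Sum>x\<in>S'. w' x) = (\<Sum>x\<in>T. z x)"
      "\<forall>i\<in>I. (\<Sum>x\<in>S'. w' x * \<phi> i x) = (\<Sum>x\<in>T. z x * \<phi> i x)"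
      "(\<Sum>x\<in>S'. w' x * g x) \<le> (\<Sum>x\<in>T. z x * g x)"
      by (elim exE conjE)
    have 1: "(\<Sum>x\<in>S'. w' x) = (\<Sum>x\<in>S. w x)" using IH(4) sumT[of "\<lambda>_. 1"] vs by simp
    have 2: "\<forall>i\<in>I. (\<Sum>x\<in>S'. w' x * \<phi> i x) = (\<Sum>x\<in>S. w x * \<phi> i x)"
      using IH(5) sumT v\<phi> by simp
    have 3: "(\<Sum>x\<in>S'. w' x * g x) \<le> (\<Sum>x\<in>S. w x * g x)"
      using IH(6) sumT[of g] mult_nonneg_nonpos[of t, OF _ vg] t by linarith
    have "S' \<subseteq> S" using IH(1) T(2) by blast
    then show ?thesis using IH(2,3) 1 2 3 by (intro exI[of _ S'] exI[of _ w'] conjI)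
  qed
qed

context prob_space
begin

text \<open>The nodes represent the cells of a finite partition on which every \<open>\<phi>\<^sub>i\<close> varies by at most \<open>\<epsilon>\<close>.\<close>

lemma finite_convex_quadrature:
  fixes \<phi> :: "'i \<Rightarrow> 'a \<Rightarrow> real"
  assumes I: "finite I" and m[measurable]: "\<And>i. i \<in> I \<Longrightarrow> \<phi> i \<in> borel_measurable M"
    and bnd: "\<And>i x. i \<in> I \<Longrightarrow> \<bar>\<phi> i x\<bar> \<le> B" and \<epsilon>: "0 < \<epsilon>"
  obtains S w where "finite S" "S \<subseteq> space M" "\<forall>x\<in>S. 0 < w x" "(\<Sum>x\<in>S. w x) = 1"
    "\<forall>i\<in>I. \<bar>(\<Sum>x\<in>S. w x * \<phi> i x) - integral\<^sup>L M (\<phi> i)\<bar> \<le> \<epsilon>"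
proof -
  \<comment> \<open>The cells are the level sets of the rounded values; boundedness of the
    \<open>\<phi> i\<close> leaves finitely many.\<close>
  define q where "q x = (\<lambda>i\<in>I. \<lfloor>\<phi> i x / \<epsilon>\<rfloor>)" for x
  define T where "T = q ` space M"
  have "T \<subseteq> PiE I (\<lambda>_. {\<lfloor>- B / \<epsilon>\<rfloor>..\<lfloor>B / \<epsilon>\<rfloor>})"
  proof -
    have "- B / \<epsilon> \<le> \<phi> i x / \<epsilon>" "\<phi> i x / \<epsilon> \<le> B / \<epsilon>" if "i \<in> I" for i x
      using bnd[OF that, of x] \<epsilon> by (intro divide_right_mono; linarith)+
    then show ?thesis by (auto simp: T_def q_def intro!: floor_mono)
  qed
  then have finT: "finite T" by (rule finite_subset) (intro finite_PiE I, simp)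
  define r where "r t = (SOME x. x \<in> space M \<and> q x = t)" for t
  have r: "r t \<in> space M \<and> q (r t) = t" if "t \<in> T" for t
  proof -
    have "\<exists>x. x \<in> space M \<and> q x = t" using that by (auto simp: T_def)
    then show ?thesis unfolding r_def by (rule someI_ex)
  qed
  define E where "E t = {x \<in> space M. q x = t}" for t
  have Em: "E t \<in> sets M" if "t \<in> T" for t
  proof -
    have "E t = {x \<in> space M. \<forall>i\<in>I. \<lfloor>\<phi> i x / \<epsilon>\<rfloor> = t i}"
    proof -
      have "q (r t) \<in> extensional I" by (simp add: q_def)
      then have "t \<in> extensional I" using r[OF that] by simp
      then show ?thesis by (auto simp: E_def q_def fun_eq_iff extensional_def)
    qed
    also have "\<dots> \<in> sets M" using I by (intro sets.sets_Collect_finite_All) measurable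
    finally show ?thesis .
  qed
  define p where "p t = measure M (E t)" for t
  \<comment> \<open>\<open>f\<close> is arbitrary: composed with \<open>r\<close> and
    \<open>q\<close> it takes finitely many values on measurable cells, hence is simple.\<close>
  have step: "integrable M (\<lambda>x. f (r (q x)))" "(\<integral>x. f (r (q x)) \<partial>M) = (\<Sum>t\<in>T. p t * f (r t))"
    for f :: "'a \<Rightarrow> real"
  proof -
    have eq: "f (r (q x)) = (\<Sum>t\<in>T. indicator (E t) x * f (r t))" if "x \<in> space M" for x
    proof -
      have "(\<Sum>t\<in>T. indicator (E t) x * f (r t)) = (\<Sum>t\<in>T. if t = q x then f (r (q x)) else 0)"
        using that by (intro sum.cong) (auto simp: E_def)
      then show ?thesis using finT that by (simp add: T_def)
    qed
    have i: "integrable M (\<lambda>x. indicator (E t) x * f (r t))" if "t \<in> T" for t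
      using Em[OF that] by (intro integrable_mult_left) (simp add: emeasure_eq_measure)
    show "integrable M (\<lambda>x. f (r (q x)))"
      using i eq by (subst Bochner_Integration.integrable_cong[OF refl eq]) auto
    show "(\<integral>x. f (r (q x)) \<partial>M) = (\<Sum>t\<in>T. p t * f (r t))"
      using i Em
      by (subst Bochner_Integration.integral_cong[OF refl eq])
        (auto simp: p_def Bochner_Integration.integral_sum)
  qed
  \<comment> \<open>Null cells are discarded because the reduction of the support starts from
    strictly positive weights.\<close>
  define T' where "T' = {t\<in>T. 0 < p t}"
  have inj: "inj_on r T'" using r by (intro inj_on_inverseI[of _ q]) (auto simp: T'_def)
  define w where "w x = p (q x)" for x
  have sum: "(\<Sum>x\<in>r ` T'. w x * f x) = (\<integral>x. f (r (q x)) \<partial>M)" for f :: "'a \<Rightarrow> real"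
  proof -
    have "(\<Sum>x\<in>r ` T'. w x * f x) = (\<Sum>t\<in>T'. p t * f (r t))"
      unfolding sum.reindex[OF inj] using r by (intro sum.cong) (auto simp: w_def T'_def)
    also have "\<dots> = (\<Sum>t\<in>T. p t * f (r t))"
      using finT by (intro sum.mono_neutral_left) (auto simp: T'_def p_def zero_less_measure_iff)
    finally show ?thesis using step(2) by simp
  qed
  show ?thesis
  proof
    show "finite (r ` T')" using finT by (simp add: T'_def)
    show "r ` T' \<subseteq> space M" using r by (auto simp: T'_def)
    show "\<forall>x\<in>r ` T'. 0 < w x" using r by (auto simp: w_def T'_def)
    show "(\<Sum>x\<in>r ` T'. w x) = 1" using sum[of "\<lambda>_. 1"] by (simp add: prob_space)
    show "\<forall>i\<in>I. \<bar>(\<Sum>x\<in>r ` T'. w x * \<phi> i x) - integral\<^sup>L M (\<phi> i)\<bar> \<le> \<epsilon>"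
    proof
      fix i assume i: "i \<in> I"
      have int: "integrable M (\<phi> i)"
        using bnd[OF i] i by (intro integrable_const_bound[of _ B]) auto
      have near: "\<bar>\<phi> i (r (q x)) - \<phi> i x\<bar> \<le> \<epsilon>" if x: "x \<in> space M" for x
      proof -
        have "q (r (q x)) = q x" using r[of "q x"] x by (auto simp: T_def)
        then have "q (r (q x)) i = q x i" by simp
        then have "\<lfloor>\<phi> i (r (q x)) / \<epsilon>\<rfloor> = \<lfloor>\<phi> i x / \<epsilon>\<rfloor>" using i by (simp add: q_def)
        then have "\<bar>\<phi> i (r (q x)) / \<epsilon> - \<phi> i x / \<epsilon>\<bar> \<le> 1" by linarith
        then show ?thesis using \<epsilon> by (simp add: diff_divide_distrib[symmetric] abs_divide)
      qed
      have "\<bar>(\<integral>x. \<phi> i (r (q x)) - \<phi> i x \<partial>M)\<bar> \<le> (\<integral>x. \<bar>\<phi> i (r (q x)) - \<phi> i x\<bar> \<partial>M)"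
        by (rule integral_abs_bound)
      also have "\<dots> \<le> (\<integral>x. \<epsilon> \<partial>M)"
        using near int step(1) by (intro integral_mono) auto
      finally show "\<bar>(\<Sum>x\<in>r ` T'. w x * \<phi> i x) - integral\<^sup>L M (\<phi> i)\<bar> \<le> \<epsilon>"
        using int step(1) by (simp add: sum prob_space)
    qed
  qed
qed

end

section \<open>Truncated Mercer expansions\<close>

definition eigenvalue_tail :: "(nat \<Rightarrow> real) \<Rightarrow> nat \<Rightarrow> real" where
  "eigenvalue_tail \<sigma> m = (\<Sum>\<^sub>\<infinity>i\<in>{m<..}. \<sigma> i)"

text \<open>Links the unordered sum, in which the theorem states the tail, to an ordered series;
  nonnegativity makes the convergence unconditional.\<close>

lemma eigenvalue_tail_sums:
  assumes "summable (\<lambda>i. \<sigma> (Suc i))" "\<And>i. 1 \<le> i \<Longrightarrow> 0 \<le> \<sigma> i"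
  shows "(\<lambda>i. \<sigma> (Suc (i + m))) sums eigenvalue_tail \<sigma> m"
proof -
  have sm: "summable (\<lambda>i. \<sigma> (Suc (i + m)))"
    using summable_ignore_initial_segment[OF assms(1), of m] by simp
  have "((\<lambda>i. \<sigma> (Suc (i + m))) has_sum (\<Sum>i. \<sigma> (Suc (i + m)))) UNIV"
    by (rule sums_nonneg_imp_has_sum) (use sm assms(2) in \<open>auto intro: summable_sums\<close>)
  then have "((\<sigma> \<circ> (\<lambda>i. Suc (i + m))) has_sum (\<Sum>i. \<sigma> (Suc (i + m)))) UNIV" by (simp add: o_def)
  then have "(\<sigma> has_sum (\<Sum>i. \<sigma> (Suc (i + m)))) (range (\<lambda>i. Suc (i + m)))"
    by (subst has_sum_reindex) (auto simp: inj_on_def)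
  moreover have "range (\<lambda>i. Suc (i + m)) = {m<..}"
  proof (intro equalityI subsetI)
    fix x assume "x \<in> {m<..}"
    then have "x = Suc (x - Suc m + m)" by auto
    then show "x \<in> range (\<lambda>i. Suc (i + m))" by blast
  qed auto
  ultimately have "eigenvalue_tail \<sigma> m = (\<Sum>i. \<sigma> (Suc (i + m)))"
    unfolding eigenvalue_tail_def by (simp add: infsumI)
  then show ?thesis using summable_sums[OF sm] by simp
qed

text \<open>\<open>1 \<le> K\<close> lets a single constant bound both \<open>k x x\<close> and its
  square root. The decay of the eigenvalues enters here only as summability; rates are supplied at
  the end.\<close>

locale mercer_rkhs = prob_space M + rkhs k H ip
  for M :: "'a measure" and k :: "'a \<Rightarrow> 'a \<Rightarrow> real" and H ip +
  fixes \<sigma> :: "nat \<Rightarrow> real" and e :: "nat \<Rightarrow> 'a \<Rightarrow> real" and K :: real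
  assumes space_M: "space M = UNIV"
    and K_ge_1: "1 \<le> K" and kernel_le: "\<And>x. k x x \<le> K"
    and eigenpairs: "ordered_eigenpairs M k \<sigma> e"
    and mercer: "\<And>x y. (\<lambda>i. \<sigma> (Suc i) * e (Suc i) x * e (Suc i) y) sums k x y"
    and onb: "orthonormal_basis_of H ip {i. 1 \<le> i \<and> 0 < \<sigma> i} (\<lambda>i x. sqrt (\<sigma> i) * e i x)"
    and summable_eigenvalues: "summable (\<lambda>i. \<sigma> (Suc i))"
begin

definition feature :: "nat \<Rightarrow> 'a \<Rightarrow> real" where
  "feature i x = sqrt (\<sigma> i) * e i x"

text \<open>Zero eigenvalues are left out because their features vanish and cannot belong to an
  orthonormal system.\<close>

definition modes :: "nat \<Rightarrow> nat set" where
  "modes m = {i. 1 \<le> i \<and> i \<le> m \<and> 0 < \<sigma> i}"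

text \<open>The diagonal of the kernel minus its truncated Mercer expansion; geometrically, the
  squared distance in \<open>H\<close> of \<open>k x\<close> from the span of the features in
  \<open>modes m\<close>.\<close>

definition truncation_error :: "nat \<Rightarrow> 'a \<Rightarrow> real" where
  "truncation_error m x = k x x - (\<Sum>i\<in>modes m. (feature i x)\<^sup>2)"

abbreviation tail :: "nat \<Rightarrow> real" where "tail \<equiv> eigenvalue_tail \<sigma>"

lemma eigenvalue_nonneg: "1 \<le> i \<Longrightarrow> 0 \<le> \<sigma> i"
  using eigenpairs by (auto simp: ordered_eigenpairs_def)

lemma eigenfunction_measurable: "1 \<le> i \<Longrightarrow> e i \<in> borel_measurable M"
  using eigenpairs by (auto simp: ordered_eigenpairs_def)

lemma eigenfunction_square:
  assumes "1 \<le> i"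
  shows "integrable M (\<lambda>x. e i x * e i x)" "(\<integral>x. e i x * e i x \<partial>M) = 1"
  using eigenpairs assms by (auto simp: ordered_eigenpairs_def power2_eq_square)

lemma finite_modes [simp]: "finite (modes m)"
  by (rule finite_subset[of _ "{1..m}"]) (auto simp: modes_def)

lemma card_modes: "card (modes m) \<le> m"
proof -
  have "card (modes m) \<le> card {1..m}" by (intro card_mono) (auto simp: modes_def)
  then show ?thesis by simp
qed

lemma orthonormal_feature: "orthonormal_on (modes m) feature"
  using onb unfolding orthonormal_on_def orthonormal_basis_of_def modes_def feature_def[abs_def] by auto

lemma feature_mem: "i \<in> modes m \<Longrightarrow> feature i \<in> H"
  using orthonormal_feature[of m] by (auto simp: orthonormal_on_def)

lemma feature_measurable: "i \<in> modes m \<Longrightarrow> feature i \<in> borel_measurable M"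
  unfolding feature_def[abs_def] using eigenfunction_measurable[of i] by (auto simp: modes_def)

lemma ip_kernel: "f \<in> H \<Longrightarrow> ip (k x) f = f x"
  by (subst ip_commute) (auto simp: reproducing kernel_mem)

lemma sqrt_le_K:
  assumes "a \<le> K"
  shows "sqrt a \<le> K"
proof -
  have "a \<le> K\<^sup>2" using assms self_le_power[OF K_ge_1, of 2] by simp
  then have "sqrt a \<le> sqrt (K\<^sup>2)" by (rule real_sqrt_le_mono)
  then show ?thesis using K_ge_1 by simp
qed

lemma ip_norm_kernel_le: "ip_norm ip (k x) \<le> K"
  by (simp add: ip_norm_def reproducing kernel_mem sqrt_le_K kernel_le)

lemma point_evaluation_le: "f \<in> H \<Longrightarrow> \<bar>f x\<bar> \<le> ip_norm ip f * K"
  using cauchy_schwarz[of f "k x"] reproducing[of f x] kernel_mem[of x] ip_norm_kernel_le[of x]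
    mult_left_mono[of "ip_norm ip (k x)" K "ip_norm ip f"] ip_norm_nonneg[of f] by simp

lemma feature_le: "i \<in> modes m \<Longrightarrow> \<bar>feature i x\<bar> \<le> K"
  using point_evaluation_le[OF feature_mem, of i m x] orthonormal_feature[of m]
  by (auto simp: orthonormal_on_def ip_norm_def)

lemma kernel_diag_measurable: "(\<lambda>x. k x x) \<in> borel_measurable M"
proof -
  have "(\<lambda>x. k x x) = (\<lambda>x. \<Sum>i. \<sigma> (Suc i) * e (Suc i) x * e (Suc i) x)"
    using mercer by (auto simp: sums_iff)
  moreover have "e (Suc i) \<in> borel_measurable M" for i by (rule eigenfunction_measurable) simp
  ultimately show ?thesis by simp
qed

lemma truncation_error_measurable [measurable]: "truncation_error m \<in> borel_measurable M"
  unfolding truncation_error_def[abs_def]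
  using kernel_diag_measurable feature_measurable[of _ m]
  by (intro borel_measurable_diff borel_measurable_sum borel_measurable_power) auto

lemma truncation_error_eq_norm:
  "sqrt (truncation_error m x) = ip_norm ip (resid (modes m) feature (k x))"
  using ip_resid_resid[OF finite_modes orthonormal_feature kernel_mem kernel_mem, of m x x]
  by (simp add: truncation_error_def ip_norm_def reproducing kernel_mem power2_eq_square
      ip_kernel feature_mem)

lemma truncation_error_nonneg: "0 \<le> truncation_error m x"
proof -
  have "(\<Sum>i\<in>modes m. (ip (k x) (feature i))\<^sup>2) \<le> ip (k x) (k x)"
    by (rule bessel[OF finite_modes orthonormal_feature kernel_mem])
  then show ?thesis
    by (simp add: truncation_error_def ip_kernel feature_mem kernel_mem)
qed

lemma truncation_error_le: "truncation_error m x \<le> K"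
proof -
  have "0 \<le> (\<Sum>i\<in>modes m. (feature i x)\<^sup>2)" by (simp add: sum_nonneg)
  then show ?thesis using kernel_le[of x] unfolding truncation_error_def by linarith
qed

lemma sqrt_truncation_error_le: "sqrt (truncation_error m x) \<le> K"
  by (intro sqrt_le_K truncation_error_le)

lemma truncation_error_integrable: "integrable M (truncation_error m)"
  using truncation_error_nonneg truncation_error_le
  by (intro integrable_const_bound[of _ K]) auto

lemma sqrt_truncation_error_integrable: "integrable M (\<lambda>x. sqrt (truncation_error m x))"
  using truncation_error_nonneg sqrt_truncation_error_le
  by (intro integrable_const_bound[of _ K]) auto

text \<open>Termwise integration of the Mercer series on the diagonal, justified by nonnegative
  terms with summable integrals; each normalized eigenfunction contributes its eigenvalue.\<close>

lemma integral_truncation_error: "integral\<^sup>L M (truncation_error m) = tail m"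
proof -
  define f where "f i x = \<sigma> (Suc (i + m)) * (e (Suc (i + m)) x * e (Suc (i + m)) x)" for i x
  have f0: "0 \<le> f i x" for i x by (simp add: f_def eigenvalue_nonneg)
  have fs: "(\<lambda>i. f i x) sums truncation_error m x" for x
  proof -
    have "(\<lambda>i. \<sigma> (Suc (i + m)) * e (Suc (i + m)) x * e (Suc (i + m)) x) sums
      (k x x - (\<Sum>i<m. \<sigma> (Suc i) * e (Suc i) x * e (Suc i) x))"
      by (rule sums_split_initial_segment[OF mercer])
    moreover have "(\<Sum>i<m. \<sigma> (Suc i) * e (Suc i) x * e (Suc i) x) = (\<Sum>i\<in>{1..m}. \<sigma> i * e i x * e i x)"
      by (rule sum.reindex_bij_witness[of _ "\<lambda>i. i - 1" Suc]) auto
    moreover have "\<dots> = (\<Sum>i\<in>modes m. \<sigma> i * e i x * e i x)"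
    proof (rule sum.mono_neutral_right)
      show "\<forall>i\<in>{1..m} - modes m. \<sigma> i * e i x * e i x = 0"
      proof
        fix i assume "i \<in> {1..m} - modes m"
        then have "1 \<le> i" "\<not> 0 < \<sigma> i" by (auto simp: modes_def)
        then have "\<sigma> i = 0" using eigenvalue_nonneg[of i] by linarith
        then show "\<sigma> i * e i x * e i x = 0" by simp
      qed
    qed (auto simp: modes_def)
    moreover have "\<dots> = (\<Sum>i\<in>modes m. (feature i x)\<^sup>2)"
      by (intro sum.cong) (auto simp: modes_def feature_def power_mult_distrib power2_eq_square[of "e _ _"])
    ultimately show ?thesis by (simp add: f_def truncation_error_def mult.assoc)
  qed
  have int: "integrable M (f i)" "(\<integral>x. f i x \<partial>M) = \<sigma> (Suc (i + m))" for i
    using eigenfunction_square[of "Suc (i + m)"] by (auto simp: f_def[abs_def])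
  have tl: "(\<lambda>i. \<sigma> (Suc (i + m))) sums tail m"
    by (rule eigenvalue_tail_sums[OF summable_eigenvalues eigenvalue_nonneg])
  have "(\<integral>x. (\<Sum>i. f i x) \<partial>M) = (\<Sum>i. \<integral>x. f i x \<partial>M)"
  proof (rule integral_suminf)
    show "AE x in M. summable (\<lambda>i. norm (f i x))"
      using fs f0 by (auto simp: sums_iff)
    show "summable (\<lambda>i. \<integral>x. norm (f i x) \<partial>M)"
      using f0 tl by (simp add: int sums_iff)
  qed (rule int)
  moreover have "(\<lambda>x. \<Sum>i. f i x) = truncation_error m"
    using fs by (auto simp: sums_iff)
  ultimately show ?thesis using tl by (simp add: int sums_iff)
qed

lemma tail_nonneg: "0 \<le> tail m"
  unfolding integral_truncation_error[symmetric] by (intro Bochner_Integration.integral_nonneg truncation_error_nonneg)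

text \<open>Jensen's inequality under \<open>M\<close>, again read off from a nonnegative
  variance.\<close>

lemma integral_sqrt_truncation_error_le: "(\<integral>x. sqrt (truncation_error m x) \<partial>M) \<le> sqrt (tail m)"
proof -
  have "0 \<le> variance (\<lambda>x. sqrt (truncation_error m x))" by (rule variance_positive)
  also have "\<dots> = tail m - (\<integral>x. sqrt (truncation_error m x) \<partial>M)\<^sup>2"
    using variance_eq[OF sqrt_truncation_error_integrable[of m]] truncation_error_integrable[of m]
      truncation_error_nonneg integral_truncation_error[of m] by simp
  finally show ?thesis by (simp add: real_le_rsqrt)
qed

text \<open>Convergence in \<open>H\<close> implies uniform convergence by the reproducing property,
  so every element of \<open>H\<close> is a uniform limit of finite combinations of
  eigenfunctions.\<close>

lemma rkhs_measurable:
  assumes f: "f \<in> H"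
  shows "f \<in> borel_measurable M"
proof -
  define F where "F n = (SOME g. g \<in> borel_measurable M \<and> (\<forall>x. \<bar>f x - g x\<bar> \<le> inverse (real (Suc n))))" for n
  have F: "F n \<in> borel_measurable M \<and> (\<forall>x. \<bar>f x - F n x\<bar> \<le> inverse (real (Suc n)))" for n
  proof -
    have "0 < inverse (real (Suc n)) / K" using K_ge_1 by simp
    then have "\<exists>J c. finite J \<and> J \<subseteq> {i. 1 \<le> i \<and> 0 < \<sigma> i} \<and>
      ip_norm ip (\<lambda>x. f x - (\<Sum>j\<in>J. c j * (sqrt (\<sigma> j) * e j x))) < inverse (real (Suc n)) / K"
      using onb f unfolding orthonormal_basis_of_def by blast
    then obtain J c where J: "finite J" "J \<subseteq> {i. 1 \<le> i \<and> 0 < \<sigma> i}"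
      and d: "ip_norm ip (\<lambda>x. f x - (\<Sum>j\<in>J. c j * (sqrt (\<sigma> j) * e j x))) < inverse (real (Suc n)) / K"
      by (elim exE conjE)
    define g where "g x = (\<Sum>j\<in>J. c j * (sqrt (\<sigma> j) * e j x))" for x
    have gm: "g \<in> borel_measurable M"
      unfolding g_def[abs_def] using J(2) eigenfunction_measurable
      by (intro borel_measurable_sum borel_measurable_times) auto
    have gH: "g \<in> H" unfolding g_def[abs_def]
      using J onb by (intro sum_mem) (auto simp: orthonormal_basis_of_def)
    have "\<bar>f x - g x\<bar> \<le> inverse (real (Suc n))" for x
    proof -
      have "\<bar>f x - g x\<bar> \<le> ip_norm ip (\<lambda>x. f x - g x) * K"
        by (rule point_evaluation_le[OF diff_mem[OF f gH]])
      also have "\<dots> \<le> inverse (real (Suc n)) / K * K"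
        using d K_ge_1 by (intro mult_right_mono) (auto simp: g_def)
      finally show ?thesis using K_ge_1 by simp
    qed
    then have "\<exists>g. g \<in> borel_measurable M \<and> (\<forall>x. \<bar>f x - g x\<bar> \<le> inverse (real (Suc n)))"
      using gm by blast
    then show ?thesis unfolding F_def by (rule someI_ex)
  qed
  show ?thesis
  proof (rule borel_measurable_LIMSEQ_real[of _ F])
    show "F i \<in> borel_measurable M" for i using F by blast
    fix x
    have "(\<lambda>n. f x - F n x) \<longlonglongrightarrow> 0"
      by (rule Lim_null_comparison[OF _ LIMSEQ_inverse_real_of_nat]) (use F in auto)
    then have "(\<lambda>n. f x - (f x - F n x)) \<longlonglongrightarrow> f x - 0" by (intro tendsto_diff tendsto_const)
    then show "(\<lambda>n. F n x) \<longlonglongrightarrow> f x" by simp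
  qed
qed

lemma rkhs_integrable: "f \<in> H \<Longrightarrow> integrable M f"
  using point_evaluation_le[of f] by (intro integrable_const_bound[of _ "ip_norm ip f * K"] rkhs_measurable) auto

text \<open>Self-adjointness and idempotence of the residual map turn the value at \<open>x\<close>
  into an inner product of two residuals, to which Cauchy-Schwarz applies.\<close>

lemma resid_point_le:
  assumes "f \<in> H"
  shows "\<bar>resid (modes m) feature f x\<bar> \<le> ip_norm ip f * sqrt (truncation_error m x)"
proof -
  let ?r = "resid (modes m) feature"
  have eq: "?r f x = ip (?r f) (?r (k x))"
    using ip_resid_resid[OF finite_modes orthonormal_feature assms kernel_mem, of m x] assms
    by (simp add: resid_def proj_def reproducing ip_kernel feature_mem)
  have "\<bar>?r f x\<bar> \<le> ip_norm ip (?r f) * ip_norm ip (?r (k x))"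
    unfolding eq
    by (intro cauchy_schwarz resid_mem finite_modes orthonormal_feature assms kernel_mem)
  also have "\<dots> \<le> ip_norm ip f * ip_norm ip (?r (k x))"
    by (rule mult_right_mono[OF resid_norm_le[OF finite_modes orthonormal_feature assms]
          ip_norm_nonneg[OF resid_mem[OF finite_modes orthonormal_feature kernel_mem]]])
  finally show ?thesis by (simp add: truncation_error_eq_norm)
qed

lemma ip_feature_le_1:
  assumes "f \<in> H" "ip_norm ip f \<le> 1" "i \<in> modes m"
  shows "\<bar>ip f (feature i)\<bar> \<le> 1"
proof -
  have "ip_norm ip (feature i) = 1"
    using orthonormal_feature[of m] assms(3) by (auto simp: orthonormal_on_def ip_norm_def)
  then show ?thesis using cauchy_schwarz[OF assms(1) feature_mem[OF assms(3)]] assms(2) by simp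
qed

text \<open>A function in the unit ball splits into features in \<open>modes s\<close> and a
  residual dominated by \<open>g\<close>. Each feature is integrated up to
  \<open>\<epsilon>\<close>. The residual enters once through the rule and once through
  \<open>M\<close>, each time at the cost of a mean of \<open>g\<close>: hence
  \<open>2 * sqrt (tail s)\<close>.\<close>

lemma convex_quadrature_exists:
  assumes \<epsilon>: "0 < \<epsilon>"
  obtains w X where "convex_weights (s + 1) w"
    "wce H ip M (quadrature (s + 1) w X) \<le> 2 * sqrt (tail s) + (real s + 1) * \<epsilon>"
proof -
  define g where "g x = sqrt (truncation_error s x)" for x
  have g0: "0 \<le> g x" for x by (simp add: g_def truncation_error_nonneg)
  \<comment> \<open>\<open>None\<close> adds \<open>g\<close> to the functions that are discretized.
    In the reduction below \<open>g\<close> is the quantity that must not grow, so it costs no extra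
    node.\<close>
  define \<phi> where "\<phi> i = (case i of None \<Rightarrow> g | Some j \<Rightarrow> feature j)" for i
  define I where "I = insert None (Some ` modes s)"
  have meas: "\<phi> i \<in> borel_measurable M" if "i \<in> I" for i
    using that by (auto simp: \<phi>_def I_def g_def[abs_def] intro: feature_measurable)
  have bnd: "\<bar>\<phi> i x\<bar> \<le> K" if "i \<in> I" for i x
    using that by (auto simp: \<phi>_def I_def g_def truncation_error_nonneg sqrt_truncation_error_le
        intro: feature_le)
  have finI: "finite I" by (simp add: I_def)
  obtain S v where S: "finite S" "S \<subseteq> space M" "\<forall>x\<in>S. 0 < v x" "(\<Sum>x\<in>S. v x) = 1"
    and appr: "\<forall>i\<in>I. \<bar>(\<Sum>x\<in>S. v x * \<phi> i x) - integral\<^sup>L M (\<phi> i)\<bar> \<le> \<epsilon>"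
    by (rule finite_convex_quadrature[OF finI meas bnd \<epsilon>]) blast
  have "\<exists>S' w'. S' \<subseteq> S \<and> card S' \<le> card (modes s) + 1 \<and> (\<forall>x\<in>S'. 0 < w' x) \<and>
    (\<Sum>x\<in>S'. w' x) = (\<Sum>x\<in>S. v x) \<and>
    (\<forall>i\<in>modes s. (\<Sum>x\<in>S'. w' x * feature i x) = (\<Sum>x\<in>S. v x * feature i x)) \<and>
    (\<Sum>x\<in>S'. w' x * g x) \<le> (\<Sum>x\<in>S. v x * g x)"
    by (rule caratheodory_reduction[OF finite_modes S(1)]) (use S(3) in blast)
  then obtain T u where T: "T \<subseteq> S" "card T \<le> card (modes s) + 1" "\<forall>x\<in>T. 0 < u x"
    "(\<Sum>x\<in>T. u x) = (\<Sum>x\<in>S. v x)"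
    "\<forall>i\<in>modes s. (\<Sum>x\<in>T. u x * feature i x) = (\<Sum>x\<in>S. v x * feature i x)"
    "(\<Sum>x\<in>T. u x * g x) \<le> (\<Sum>x\<in>S. v x * g x)"
    by (elim exE conjE)
  have finT: "finite T" using T(1) S(1) finite_subset by blast
  have cT: "card T \<le> s + 1" using T(2) card_modes[of s] by simp
  obtain h where h: "bij_betw h {1..card T} T" using ex_bij_betw_nat_finite_1[OF finT] by blast
  \<comment> \<open>Padding with zero weights gives exactly \<open>s + 1\<close> nodes.\<close>
  define w where "w i = (if i \<le> card T then u (h i) else 0)" for i
  have Q: "quadrature (s + 1) w h f = (\<Sum>x\<in>T. u x * f x)" for f
  proof -
    have "quadrature (s + 1) w h f = (\<Sum>i\<in>{1..card T}. u (h i) * f (h i))"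
      unfolding quadrature_def w_def using cT by (intro sum.mono_neutral_cong_right) auto
    also have "\<dots> = (\<Sum>x\<in>T. u x * f x)" by (rule sum.reindex_bij_betw[OF h])
    finally show ?thesis .
  qed
  show ?thesis
  proof
    have "0 \<le> w i" if "i \<in> {1..s + 1}" for i
    proof (cases "i \<le> card T")
      case True
      then have "h i \<in> T" using that bij_betw_apply[OF h] by simp
      then have "0 < u (h i)" using T(3) by blast
      then show ?thesis by (simp add: w_def)
    qed (simp add: w_def)
    moreover have "(\<Sum>i=1..s + 1. w i) = 1"
      using Q[of "\<lambda>_. 1"] T(4) S(4) by (simp add: quadrature_def)
    ultimately show "convex_weights (s + 1) w" by (simp add: convex_weights_def)
    have Ig: "integral\<^sup>L M g \<le> sqrt (tail s)"
      using integral_sqrt_truncation_error_le[of s] by (simp add: g_def[abs_def])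
    have ig: "integrable M g"
      using sqrt_truncation_error_integrable[of s] by (simp add: g_def[abs_def])
    have Qg: "(\<Sum>x\<in>T. u x * g x) \<le> sqrt (tail s) + \<epsilon>"
    proof -
      have "\<bar>(\<Sum>x\<in>S. v x * g x) - integral\<^sup>L M g\<bar> \<le> \<epsilon>" using appr by (simp add: I_def \<phi>_def)
      then show ?thesis using T(6) Ig by linarith
    qed
    have Qf: "\<bar>(\<Sum>x\<in>T. u x * feature i x) - integral\<^sup>L M (feature i)\<bar> \<le> \<epsilon>" if "i \<in> modes s" for i
      using appr T(5) that by (simp add: I_def \<phi>_def)
    show "wce H ip M (quadrature (s + 1) w h) \<le> 2 * sqrt (tail s) + (real s + 1) * \<epsilon>"
      unfolding wce_def Q
    proof (rule cSUP_least)
      have "(\<lambda>x. 0) \<in> {f \<in> H. ip_norm ip f \<le> 1}"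
        using zero_mem ip_zero_left[OF zero_mem] by (simp add: ip_norm_def)
      then show "{f \<in> H. ip_norm ip f \<le> 1} \<noteq> {}" by blast
      fix f assume "f \<in> {f \<in> H. ip_norm ip f \<le> 1}"
      then have f: "f \<in> H" "ip_norm ip f \<le> 1" by auto
      define c where "c i = ip f (feature i)" for i
      define r where "r = resid (modes s) feature f"
      have rH: "r \<in> H" unfolding r_def by (intro resid_mem finite_modes orthonormal_feature f)
      have f_eq: "f x = (\<Sum>i\<in>modes s. c i * feature i x) + r x" for x
        by (simp add: r_def resid_def proj_def c_def)
      have r_le: "\<bar>r x\<bar> \<le> g x" for x
      proof -
        have "\<bar>r x\<bar> \<le> ip_norm ip f * g x" unfolding r_def g_def by (rule resid_point_le[OF f(1)])
        also have "\<dots> \<le> 1 * g x" using f(2) g0 by (intro mult_right_mono)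
        finally show ?thesis by simp
      qed
      have Q_eq: "(\<Sum>x\<in>T. u x * f x) = (\<Sum>i\<in>modes s. c i * (\<Sum>x\<in>T. u x * feature i x)) + (\<Sum>x\<in>T. u x * r x)"
      proof -
        have "(\<Sum>x\<in>T. u x * f x) = (\<Sum>x\<in>T. (\<Sum>i\<in>modes s. c i * (u x * feature i x)) + u x * r x)"
          unfolding f_eq by (simp add: distrib_left sum_distrib_left mult.left_commute)
        also have "\<dots> = (\<Sum>i\<in>modes s. \<Sum>x\<in>T. c i * (u x * feature i x)) + (\<Sum>x\<in>T. u x * r x)"
          by (subst sum.swap) (rule sum.distrib)
        finally show ?thesis by (simp add: sum_distrib_left)
      qed
      have if_: "integrable M (feature i)" if "i \<in> modes s" for i
        using rkhs_integrable[OF feature_mem[OF that]] .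
      have I_eq: "(\<integral>x. f x \<partial>M) = (\<Sum>i\<in>modes s. c i * integral\<^sup>L M (feature i)) + integral\<^sup>L M r"
        unfolding f_eq using if_ rkhs_integrable[OF rH]
        by (subst Bochner_Integration.integral_add) (auto simp: Bochner_Integration.integral_sum)
      \<comment> \<open>Coefficients of a function in the unit ball have size at most 1, and there
        are at most \<open>s\<close> modes.\<close>
      have 1: "\<bar>\<Sum>i\<in>modes s. c i * ((\<Sum>x\<in>T. u x * feature i x) - integral\<^sup>L M (feature i))\<bar> \<le> real s * \<epsilon>"
      proof -
        have "\<bar>\<Sum>i\<in>modes s. c i * ((\<Sum>x\<in>T. u x * feature i x) - integral\<^sup>L M (feature i))\<bar>
          \<le> (\<Sum>i\<in>modes s. \<bar>c i\<bar> * \<bar>(\<Sum>x\<in>T. u x * feature i x) - integral\<^sup>L M (feature i)\<bar>)"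
          by (rule order_trans[OF sum_abs]) (simp add: abs_mult)
        also have "\<dots> \<le> (\<Sum>i\<in>modes s. 1 * \<epsilon>)"
          using ip_feature_le_1[OF f] Qf by (intro sum_mono mult_mono) (auto simp: c_def)
        also have "\<dots> \<le> real s * \<epsilon>" using card_modes[of s] \<epsilon> by simp
        finally show ?thesis .
      qed
      have 2: "\<bar>\<Sum>x\<in>T. u x * r x\<bar> \<le> (\<Sum>x\<in>T. u x * g x)"
        using T(3) r_le
        by (intro order_trans[OF sum_abs] sum_mono) (auto simp: abs_mult intro!: mult_mono)
      have 3: "\<bar>integral\<^sup>L M r\<bar> \<le> integral\<^sup>L M g"
        using r_le rkhs_integrable[OF rH] ig
        by (intro order_trans[OF integral_abs_bound] integral_mono) auto
      have "(\<Sum>x\<in>T. u x * f x) - (\<integral>x. f x \<partial>M) =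
        (\<Sum>i\<in>modes s. c i * ((\<Sum>x\<in>T. u x * feature i x) - integral\<^sup>L M (feature i)))
          + (\<Sum>x\<in>T. u x * r x) - integral\<^sup>L M r"
        unfolding Q_eq I_eq by (simp add: right_diff_distrib sum_subtractf)
      then have "\<bar>(\<Sum>x\<in>T. u x * f x) - (\<integral>x. f x \<partial>M)\<bar> \<le> real s * \<epsilon> + (sqrt (tail s) + \<epsilon>) + sqrt (tail s)"
        using 1 2 3 Qg Ig by linarith
      then show "\<bar>(\<Sum>x\<in>T. u x * f x) - (\<integral>x. f x \<partial>M)\<bar> \<le> 2 * sqrt (tail s) + (real s + 1) * \<epsilon>"
        by (simp add: algebra_simps)
    qed
  qed
qed

end

section \<open>The Nystroem projection\<close>

context rkhs
begin

text \<open>The last identity holds because the kernel sections \<open>k(z\<^sub>j, \<cdot>)\<close> lie in the span of the \<open>v\<^sub>r\<close>.\<close>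

lemma gram_eigenvectors:
  assumes dec: "ordered_eigendecomposition l (\<lambda>i j. k (Z i) (Z j)) U lam"
  defines "I \<equiv> {r \<in> {1..l}. 0 < lam r}"
  obtains v where "orthonormal_on I v"
    "\<forall>r\<in>I. \<forall>x. v r x = (\<Sum>j=1..l. U j r * k (Z j) x) / sqrt (lam r)"
    "\<forall>r\<in>I. \<forall>j\<in>{1..l}. v r (Z j) = sqrt (lam r) * U j r"
    "\<forall>h\<in>H. (\<Sum>j=1..l. (h (Z j))\<^sup>2) = (\<Sum>r\<in>I. lam r * (ip h (v r))\<^sup>2)"
proof -
  have ort: "(\<Sum>j=1..l. U j r * U j q) = (if r = q then 1 else 0)" if "r \<in> {1..l}" "q \<in> {1..l}" for r q
    using dec that unfolding ordered_eigendecomposition_def by blast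
  have gram: "k (Z i) (Z j) = (\<Sum>r=1..l. U i r * lam r * U j r)" if "i \<in> {1..l}" "j \<in> {1..l}" for i j
    using dec that unfolding ordered_eigendecomposition_def by blast
  have nonneg: "0 \<le> lam r" if "r \<in> {1..l}" for r
    using dec that unfolding ordered_eigendecomposition_def by blast
  have finI: "finite I" by (simp add: I_def)
  have eig: "(\<Sum>j=1..l. k (Z i) (Z j) * U j r) = lam r * U i r" if "i \<in> {1..l}" "r \<in> {1..l}" for i r
  proof -
    have "(\<Sum>j=1..l. k (Z i) (Z j) * U j r) = (\<Sum>j=1..l. \<Sum>q=1..l. U i q * lam q * (U j q * U j r))"
      using that by (intro sum.cong) (auto simp: gram sum_distrib_right mult.assoc)
    also have "\<dots> = (\<Sum>q=1..l. \<Sum>j=1..l. U i q * lam q * (U j q * U j r))" by (rule sum.swap)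
    also have "\<dots> = (\<Sum>q=1..l. U i q * lam q * (if q = r then 1 else 0))"
    proof (rule sum.cong[OF refl])
      fix q assume "q \<in> {1..l}"
      then show "(\<Sum>j=1..l. U i q * lam q * (U j q * U j r)) = U i q * lam q * (if q = r then 1 else 0)"
        unfolding sum_distrib_left[symmetric] using ort[OF _ that(2)] by simp
    qed
    also have "\<dots> = (\<Sum>q=1..l. if q = r then U i q * lam q else 0)" by (intro sum.cong) auto
    finally show ?thesis using that by simp
  qed
  \<comment> \<open>The unscaled combination has squared norm \<open>lam r\<close> when
    \<open>r \<in> I\<close>, which explains the divisor.\<close>
  define v where "v r x = (\<Sum>j=1..l. (U j r / sqrt (lam r)) * k (Z j) x)" for r x
  have vH: "v r \<in> H" for r unfolding v_def[abs_def] by (rule sum_mem) (auto simp: kernel_mem)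
  have v_eq: "v r x = (\<Sum>j=1..l. U j r * k (Z j) x) / sqrt (lam r)" for r x
    by (simp add: v_def sum_divide_distrib)
  have k_sym: "k x y = k y x" for x y
    using reproducing[OF kernel_mem[of x], of y] reproducing[OF kernel_mem[of y], of x]
      ip_commute[OF kernel_mem[of x] kernel_mem[of y]] by simp
  have v_Z: "v r (Z j) = sqrt (lam r) * U j r" if "r \<in> I" "j \<in> {1..l}" for r j
  proof -
    have "(\<Sum>i=1..l. U i r * k (Z i) (Z j)) = (\<Sum>i=1..l. k (Z j) (Z i) * U i r)"
      by (intro sum.cong) (auto simp: k_sym mult.commute)
    also have "\<dots> = lam r * U j r" using that by (intro eig) (auto simp: I_def)
    finally have "v r (Z j) = lam r * U j r / sqrt (lam r)" by (simp add: v_eq)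
    also have "\<dots> = (lam r / sqrt (lam r)) * U j r" by simp
    also have "lam r / sqrt (lam r) = sqrt (lam r)" using that nonneg by (simp add: I_def real_div_sqrt)
    finally show ?thesis .
  qed
  have ip_v: "ip h (v r) = (\<Sum>j=1..l. (U j r / sqrt (lam r)) * h (Z j))" if "h \<in> H" for h r
    unfolding v_def[abs_def] using that by (subst ip_sum_right) (auto simp: kernel_mem reproducing)
  have on: "orthonormal_on I v"
    unfolding orthonormal_on_def
  proof (intro conjI ballI vH)
    fix q r assume qr: "q \<in> I" "r \<in> I"
    have "ip (v q) (v r) = (\<Sum>j=1..l. (U j r / sqrt (lam r)) * (sqrt (lam q) * U j q))"
      unfolding ip_v[OF vH] using qr by (intro sum.cong) (auto simp: v_Z)
    also have "\<dots> = (sqrt (lam q) / sqrt (lam r)) * (\<Sum>j=1..l. U j q * U j r)"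
      by (simp add: sum_distrib_left mult_ac)
    also have "\<dots> = (if q = r then 1 else 0)"
      using qr ort[of q r] by (simp add: I_def)
    finally show "ip (v q) (v r) = (if q = r then 1 else 0)" .
  qed
  \<comment> \<open>The squared residual norm is \<open>k (Z j) (Z j)\<close> minus its spectral
    expansion, hence zero.\<close>
  have span: "resid I v (k (Z j)) = (\<lambda>x. 0)" if j: "j \<in> {1..l}" for j
  proof -
    have "ip (k (Z j)) (v r) = sqrt (lam r) * U j r" if "r \<in> I" for r
      using v_Z[OF that j] ip_commute[OF kernel_mem vH, of "Z j" r] reproducing[OF vH, of r "Z j"] by simp
    then have "(\<Sum>r\<in>I. ip (k (Z j)) (v r) * ip (k (Z j)) (v r)) = (\<Sum>r\<in>I. U j r * lam r * U j r)"
      using nonneg by (intro sum.cong) (auto simp: I_def)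
    also have "\<dots> = (\<Sum>r=1..l. U j r * lam r * U j r)"
    proof (rule sum.mono_neutral_left)
      show "\<forall>r\<in>{1..l} - I. U j r * lam r * U j r = 0"
      proof
        fix r assume "r \<in> {1..l} - I"
        then have "lam r = 0" using nonneg[of r] by (auto simp: I_def)
        then show "U j r * lam r * U j r = 0" by simp
      qed
    qed (auto simp: I_def)
    also have "\<dots> = k (Z j) (Z j)" using gram[OF j j] by simp
    finally have "ip (resid I v (k (Z j))) (resid I v (k (Z j))) = 0"
      by (simp add: ip_resid_resid[OF finI on] kernel_mem reproducing)
    then show ?thesis using ip_eq_0_iff[OF resid_mem[OF finI on kernel_mem]] by blast
  qed
  have parseval: "(\<Sum>j=1..l. (h (Z j))\<^sup>2) = (\<Sum>r\<in>I. lam r * (ip h (v r))\<^sup>2)" if h: "h \<in> H" for h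
  proof -
    have h_Z: "h (Z j) = (\<Sum>r\<in>I. sqrt (lam r) * U j r * ip h (v r))" if j: "j \<in> {1..l}" for j
    proof -
      have c: "ip (k (Z j)) (v r) = sqrt (lam r) * U j r" if "r \<in> I" for r
        using v_Z[OF that j] ip_commute[OF kernel_mem vH, of "Z j" r] reproducing[OF vH, of r "Z j"] by simp
      \<comment> \<open>Pairing with the vanishing residual of \<open>k (Z j)\<close> expresses the
        value \<open>h (Z j)\<close> through the coefficients of \<open>h\<close> in
        \<open>v\<close>.\<close>
      have "ip (resid I v h) (resid I v (k (Z j))) = ip (resid I v h) (\<lambda>x. 0)"
        using span[OF j] by simp
      also have "\<dots> = 0"
        using ip_zero_left[OF resid_mem[OF finI on h]] ip_commute[OF resid_mem[OF finI on h] zero_mem] by simp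
      finally have "ip h (k (Z j)) = (\<Sum>r\<in>I. ip h (v r) * ip (k (Z j)) (v r))"
        using ip_resid_resid[OF finI on h kernel_mem, of "Z j"] by simp
      also have "\<dots> = (\<Sum>r\<in>I. sqrt (lam r) * U j r * ip h (v r))"
        using c by (intro sum.cong) auto
      finally show ?thesis by (simp add: reproducing h)
    qed
    \<comment> \<open>After expansion of the square, the orthonormal columns of \<open>U\<close>
      leave only diagonal terms.\<close>
    let ?a = "\<lambda>r. sqrt (lam r) * ip h (v r)"
    have "(\<Sum>j=1..l. (h (Z j))\<^sup>2) = (\<Sum>j=1..l. \<Sum>r\<in>I. \<Sum>q\<in>I. ?a r * ?a q * (U j r * U j q))"
    proof (intro sum.cong refl)
      fix j assume "j \<in> {1..l}"
      then have "(h (Z j))\<^sup>2 = (\<Sum>r\<in>I. sqrt (lam r) * U j r * ip h (v r)) * (\<Sum>q\<in>I. sqrt (lam q) * U j q * ip h (v q))"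
        by (simp add: h_Z power2_eq_square)
      also have "\<dots> = (\<Sum>r\<in>I. \<Sum>q\<in>I. ?a r * ?a q * (U j r * U j q))"
        unfolding sum_product by (intro sum.cong refl) (simp add: mult_ac)
      finally show "(h (Z j))\<^sup>2 = (\<Sum>r\<in>I. \<Sum>q\<in>I. ?a r * ?a q * (U j r * U j q))" .
    qed
    also have "\<dots> = (\<Sum>r\<in>I. \<Sum>j=1..l. \<Sum>q\<in>I. ?a r * ?a q * (U j r * U j q))" by (rule sum.swap)
    also have "\<dots> = (\<Sum>r\<in>I. \<Sum>q\<in>I. \<Sum>j=1..l. ?a r * ?a q * (U j r * U j q))"
      by (rule sum.cong[OF refl], rule sum.swap)
    also have "\<dots> = (\<Sum>r\<in>I. \<Sum>q\<in>I. if q = r then ?a r * ?a r else 0)"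
    proof (intro sum.cong refl)
      fix r q assume "r \<in> I" "q \<in> I"
      then have "(\<Sum>j=1..l. U j r * U j q) = (if r = q then 1 else 0)" by (intro ort) (auto simp: I_def)
      then show "(\<Sum>j=1..l. ?a r * ?a q * (U j r * U j q)) = (if q = r then ?a r * ?a r else 0)"
        unfolding sum_distrib_left[symmetric] by simp
    qed
    also have "\<dots> = (\<Sum>r\<in>I. lam r * (ip h (v r))\<^sup>2)"
      using finI nonneg by (intro sum.cong) (auto simp: I_def power2_eq_square)
    finally show ?thesis .
  qed
  show ?thesis
    using on v_eq v_Z parseval by (intro that[of v]) blast+
qed

text \<open>\<open>b\<close> is any competing system of at most \<open>s\<close> orthonormal
  directions. The energy that \<open>v\<close> captures on the sample is the sum of the
  \<open>s\<close> largest eigenvalues, which is maximal by Ky Fan's inequality, so its residual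
  energy is minimal.\<close>

lemma nystroem_diag:
  assumes dec: "ordered_eigendecomposition l (\<lambda>i j. k (Z i) (Z j)) U lam" and s: "1 \<le> s" "s \<le> l"
    and J: "finite J" "orthonormal_on J b" "card J \<le> s"
  obtains I v where "finite (I :: nat set)" "orthonormal_on I v"
    "\<forall>x. k x x - nystroem k l Z U lam s x x = (ip_norm ip (resid I v (k x)))\<^sup>2"
    "(\<Sum>j=1..l. k (Z j) (Z j) - nystroem k l Z U lam s (Z j) (Z j))
      \<le> (\<Sum>j=1..l. k (Z j) (Z j) - (\<Sum>i\<in>J. (b i (Z j))\<^sup>2))"
proof -
  \<comment> \<open>All positive eigenvalues; \<open>I\<close> keeps those among the first
    \<open>s\<close>. The Parseval identity on the sample is taken over \<open>I'\<close>, the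
    projection over \<open>I\<close>.\<close>
  define I' where "I' = {r \<in> {1..l}. 0 < lam r}"
  define I where "I = {r. 1 \<le> r \<and> r \<le> s \<and> 0 < lam r}"
  have I: "finite I" "I \<subseteq> I'" "I \<subseteq> {1..s}" "finite I'" "I' \<subseteq> {1..l}"
    using s finite_subset[of I "{1..s}"] by (auto simp: I_def I'_def)
  have decr: "\<And>i j. 1 \<le> i \<Longrightarrow> i \<le> j \<Longrightarrow> j \<le> l \<Longrightarrow> lam j \<le> lam i"
    using dec unfolding ordered_eigendecomposition_def by auto
  have nonneg: "\<And>r. 1 \<le> r \<Longrightarrow> r \<le> l \<Longrightarrow> 0 \<le> lam r"
    using dec unfolding ordered_eigendecomposition_def by auto
  have ort: "(\<Sum>j=1..l. U j r * U j r) = 1" if "r \<in> {1..l}" for r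
    using dec that unfolding ordered_eigendecomposition_def by auto
  obtain v where on': "orthonormal_on I' v"
    and v: "\<forall>r\<in>I'. \<forall>x. v r x = (\<Sum>j=1..l. U j r * k (Z j) x) / sqrt (lam r)"
    and v_Z: "\<forall>r\<in>I'. \<forall>j\<in>{1..l}. v r (Z j) = sqrt (lam r) * U j r"
    and pars: "\<forall>h\<in>H. (\<Sum>j=1..l. (h (Z j))\<^sup>2) = (\<Sum>r\<in>I'. lam r * (ip h (v r))\<^sup>2)"
    using gram_eigenvectors[OF dec] unfolding I'_def by blast
  have on: "orthonormal_on I v" using on' I(2) unfolding orthonormal_on_def by blast
  have nys: "nystroem k l Z U lam s x x = (\<Sum>r\<in>I. (v r x)\<^sup>2)" for x
    unfolding nystroem_def I_def[symmetric]
  proof (rule sum.cong[OF refl])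
    fix r assume r: "r \<in> I"
    then have "0 < lam r" by (simp add: I_def)
    then show "1 / lam r * (\<Sum>j=1..l. U j r * k (Z j) x) * (\<Sum>j=1..l. U j r * k (Z j) x) = (v r x)\<^sup>2"
      using v r I(2) by (auto simp: power_divide power2_eq_square)
  qed
  have diag: "k x x - nystroem k l Z U lam s x x = (ip_norm ip (resid I v (k x)))\<^sup>2" for x
  proof -
    have c: "ip (k x) (v r) = v r x" if "r \<in> I" for r
      using that on ip_commute[OF kernel_mem, of "v r" x] by (simp add: orthonormal_on_def reproducing)
    have "(ip_norm ip (resid I v (k x)))\<^sup>2 = ip (resid I v (k x)) (resid I v (k x))"
      by (rule ip_norm_sq[OF resid_mem[OF I(1) on kernel_mem]])
    also have "\<dots> = k x x - (\<Sum>r\<in>I. ip (k x) (v r) * ip (k x) (v r))"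
      by (simp only: ip_resid_resid[OF I(1) on kernel_mem kernel_mem] reproducing[OF kernel_mem])
    finally show ?thesis using c by (simp add: nys power2_eq_square)
  qed
  have "(\<Sum>j=1..l. \<Sum>i\<in>J. (b i (Z j))\<^sup>2) = (\<Sum>i\<in>J. \<Sum>j=1..l. (b i (Z j))\<^sup>2)" by (rule sum.swap)
  also have "\<dots> = (\<Sum>i\<in>J. \<Sum>r\<in>I'. lam r * (ip (b i) (v r))\<^sup>2)"
    by (rule sum.cong[OF refl]) (use pars J(2) in \<open>simp add: orthonormal_on_def\<close>)
  also have "\<dots> \<le> (\<Sum>r=1..s. lam r)"
  proof (rule ky_fan[OF J I(5) on' _ decr nonneg s])
    show "lam r = 0" if "r \<in> {1..l} - I'" for r using that nonneg[of r] by (auto simp: I'_def)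
  qed
  also have "\<dots> = (\<Sum>r\<in>I. lam r)"
  proof (rule sum.mono_neutral_right)
    show "\<forall>r\<in>{1..s} - I. lam r = 0"
    proof
      fix r assume "r \<in> {1..s} - I"
      then show "lam r = 0" using nonneg[of r] s by (auto simp: I_def)
    qed
  qed (use I in auto)
  also have "\<dots> = (\<Sum>r\<in>I. \<Sum>j=1..l. (v r (Z j))\<^sup>2)"
  proof (rule sum.cong[OF refl])
    fix r assume r: "r \<in> I"
    then have r': "r \<in> I'" "r \<in> {1..l}" "0 < lam r" using I by (auto simp: I_def)
    have "(\<Sum>j=1..l. (v r (Z j))\<^sup>2) = (\<Sum>j=1..l. lam r * (U j r * U j r))"
      using v_Z r' by (intro sum.cong) (auto simp: power_mult_distrib power2_eq_square[of "U _ _"])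
    also have "\<dots> = lam r" using ort[OF r'(2)] by (simp add: sum_distrib_left[symmetric])
    finally show "lam r = (\<Sum>j=1..l. (v r (Z j))\<^sup>2)" by simp
  qed
  also have "\<dots> = (\<Sum>j=1..l. nystroem k l Z U lam s (Z j) (Z j))"
    unfolding nys by (rule sum.swap)
  finally have "(\<Sum>j=1..l. k (Z j) (Z j) - nystroem k l Z U lam s (Z j) (Z j))
      \<le> (\<Sum>j=1..l. k (Z j) (Z j) - (\<Sum>i\<in>J. (b i (Z j))\<^sup>2))"
    by (simp add: sum_subtractf)
  then show ?thesis using I(1) on diag by (intro that[of I v]) auto
qed

end

section \<open>Discretization of the projection class\<close>

text \<open>Subadditivity of the square root. This Hoelder bound turns a rounding error of order
  \<open>1 / G\<close> in a quadratic form into one of order \<open>1 / sqrt G\<close> in its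
  root.\<close>

lemma abs_sqrt_diff_le: "\<bar>sqrt a - sqrt b\<bar> \<le> sqrt \<bar>a - b\<bar>" if "0 \<le> a" "0 \<le> b" for a b :: real
proof -
  have *: "sqrt c \<le> sqrt d + sqrt (c - d)" if "0 \<le> d" "d \<le> c" for c d :: real
    using sqrt_add_le_add_sqrt[of d "c - d"] that by simp
  show ?thesis using *[of a b] *[of b a] that by (cases "a \<le> b") (auto simp: abs_real_def)
qed

context mercer_rkhs
begin

text \<open>A point encodes the matrix with entries \<open>t (i, j) / G\<close>, on a mesh of width
  \<open>1 / G\<close> in \<open>[-1, 1]\<close>; inner products of residuals of unit vectors lie in
  that range.\<close>

definition grid :: "nat \<Rightarrow> nat \<Rightarrow> (nat \<times> nat \<Rightarrow> int) set" where
  "grid m G = PiE (modes m \<times> modes m) (\<lambda>_. {- int G..int G})"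

text \<open>The cap at \<open>K\<close> is inactive for the forms that come from projections.\<close>

definition grid_function :: "nat \<Rightarrow> nat \<Rightarrow> (nat \<times> nat \<Rightarrow> int) \<Rightarrow> 'a \<Rightarrow> real" where
  "grid_function m G t x = min K (sqrt \<bar>\<Sum>i\<in>modes m. \<Sum>j\<in>modes m.
     real_of_int (t (i, j)) / real G * (feature i x * feature j x)\<bar>)"

lemma finite_grid: "finite (grid m G)"
  unfolding grid_def by (intro finite_PiE finite_cartesian_product finite_modes) simp

lemma grid_nonempty: "grid m G \<noteq> {}"
  by (auto simp: grid_def PiE_eq_empty_iff)

lemma ln_card_grid_le: "ln (card (grid m G)) \<le> real m ^ 2 * ln (2 * real G + 1)"
proof -
  have "card (grid m G) = (2 * G + 1) ^ (card (modes m) * card (modes m))"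
    unfolding grid_def by (subst card_PiE) (auto simp: card_cartesian_product nat_add_distrib nat_mult_distrib)
  then have "ln (card (grid m G)) = real (card (modes m) * card (modes m)) * ln (2 * real G + 1)"
    by (simp add: ln_realpow add.commute)
  also have "\<dots> \<le> real (m * m) * ln (2 * real G + 1)"
    using card_modes[of m] by (intro mult_right_mono of_nat_mono mult_le_mono) auto
  finally show ?thesis by (simp add: power2_eq_square)
qed

lemma grid_function_measurable: "grid_function m G t \<in> borel_measurable M"
proof -
  have [measurable]: "feature i \<in> borel_measurable M" if "i \<in> modes m" for i
    using feature_measurable[OF that] .
  show ?thesis unfolding grid_function_def[abs_def] by measurable
qed

lemma grid_function_bounds: "0 \<le> grid_function m G t x" "grid_function m G t x \<le> K"
  using K_ge_1 by (auto simp: grid_function_def)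

text \<open>The squared residual norm of the truncated section is a quadratic form in the features
  at \<open>x\<close> whose coefficients do not depend on \<open>x\<close>, so one grid point serves
  all \<open>x\<close>. The first error term comes from truncating \<open>k x\<close>, the second
  from rounding.\<close>

lemma grid_approximation:
  assumes I: "finite I" "orthonormal_on I v" and G: "0 < G"
  shows "\<exists>t\<in>grid m G. \<forall>x. \<bar>ip_norm ip (resid I v (k x)) - grid_function m G t x\<bar>
    \<le> sqrt (truncation_error m x) + real m * K / sqrt G"
proof -
  define r where "r = resid I v"
  define A where "A i j = ip (r (feature i)) (r (feature j))" for i j
  have A_le: "\<bar>A i j\<bar> \<le> 1" if "i \<in> modes m" "j \<in> modes m" for i j
  proof -
    have 1: "ip_norm ip (r (feature i)) \<le> 1" "r (feature i) \<in> H" "0 \<le> ip_norm ip (r (feature i))"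
      if i: "i \<in> modes m" for i
    proof -
      have "ip_norm ip (feature i) = 1"
        using orthonormal_feature[of m] i by (auto simp: orthonormal_on_def ip_norm_def)
      then show "ip_norm ip (r (feature i)) \<le> 1"
        using resid_norm_le[OF I feature_mem[OF i]] by (simp add: r_def)
      show "r (feature i) \<in> H" unfolding r_def by (rule resid_mem[OF I feature_mem[OF i]])
      then show "0 \<le> ip_norm ip (r (feature i))" by (rule ip_norm_nonneg)
    qed
    have "\<bar>A i j\<bar> \<le> ip_norm ip (r (feature i)) * ip_norm ip (r (feature j))"
      unfolding A_def by (rule cauchy_schwarz[OF 1(2)[OF that(1)] 1(2)[OF that(2)]])
    also have "\<dots> \<le> 1" using 1[OF that(1)] 1[OF that(2)] by (intro mult_le_one)
    finally show ?thesis .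
  qed
  define t where "t = (\<lambda>(i, j)\<in>modes m \<times> modes m. \<lfloor>real G * A i j\<rfloor>)"
  have "t \<in> grid m G"
    unfolding grid_def t_def
  proof (rule restrict_PiE_iff[THEN iffD2], rule ballI)
    fix p assume p: "p \<in> modes m \<times> modes m"
    obtain i j where ij: "p = (i, j)" "i \<in> modes m" "j \<in> modes m" using p by auto
    have "\<bar>real G * A i j\<bar> \<le> real G"
      using A_le[OF ij(2,3)] mult_left_mono[of "\<bar>A i j\<bar>" 1 "real G"] by (simp add: abs_mult)
    then have "- real G \<le> real G * A i j" "real G * A i j \<le> real G" by linarith+
    then have "- int G \<le> \<lfloor>real G * A i j\<rfloor>" "\<lfloor>real G * A i j\<rfloor> \<le> int G"
      by (simp_all add: le_floor_iff floor_le_iff)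
    then show "(case p of (i, j) \<Rightarrow> \<lfloor>real G * A i j\<rfloor>) \<in> {- int G..int G}" by (simp add: ij(1))
  qed
  moreover have "\<bar>ip_norm ip (r (k x)) - grid_function m G t x\<bar>
    \<le> sqrt (truncation_error m x) + real m * K / sqrt G" for x
  proof -
    define p where "p = proj (modes m) feature (k x)"
    define Q where "Q B = (\<Sum>i\<in>modes m. \<Sum>j\<in>modes m. B i j * (feature i x * feature j x))" for B :: "nat \<Rightarrow> nat \<Rightarrow> real"
    have pH: "p \<in> H" unfolding p_def by (rule proj_mem[OF finite_modes orthonormal_feature])
    have rp: "r p \<in> H" unfolding r_def by (rule resid_mem[OF I pH])
    have rk: "r (k x) \<in> H" unfolding r_def by (rule resid_mem[OF I kernel_mem])
    have p_eq: "p = (\<lambda>y. \<Sum>i\<in>modes m. feature i x * feature i y)"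
      unfolding p_def proj_def[abs_def] by (simp add: ip_kernel feature_mem)
    have ip_p: "ip p h = (\<Sum>i\<in>modes m. feature i x * ip (feature i) h)" if "h \<in> H" for h
      unfolding p_eq by (rule ip_sum_left[OF finite_modes _ that]) (rule feature_mem)
    have ip_p': "ip h p = (\<Sum>i\<in>modes m. feature i x * ip h (feature i))" if "h \<in> H" for h
      unfolding p_eq by (rule ip_sum_right[OF finite_modes _ that]) (rule feature_mem)
    have Q_A: "ip (r p) (r p) = Q A"
    proof -
      have vH: "v q \<in> H" if "q \<in> I" for q using I(2) that by (auto simp: orthonormal_on_def)
      have "ip (r p) (r p) = ip p p - (\<Sum>q\<in>I. ip p (v q) * ip p (v q))"
        unfolding r_def by (rule ip_resid_resid[OF I pH pH])
      also have "ip p p = (\<Sum>i\<in>modes m. \<Sum>j\<in>modes m. feature i x * feature j x * ip (feature i) (feature j))"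
        unfolding ip_p[OF pH]
        by (intro sum.cong refl) (simp add: ip_p' feature_mem sum_distrib_left mult.assoc)
      also have "(\<Sum>q\<in>I. ip p (v q) * ip p (v q)) = (\<Sum>q\<in>I. \<Sum>i\<in>modes m. \<Sum>j\<in>modes m.
          feature i x * feature j x * (ip (feature i) (v q) * ip (feature j) (v q)))"
        by (intro sum.cong refl) (simp add: ip_p vH sum_product mult_ac)
      also have "\<dots> = (\<Sum>i\<in>modes m. \<Sum>q\<in>I. \<Sum>j\<in>modes m.
          feature i x * feature j x * (ip (feature i) (v q) * ip (feature j) (v q)))" by (rule sum.swap)
      also have "\<dots> = (\<Sum>i\<in>modes m. \<Sum>j\<in>modes m. \<Sum>q\<in>I.
          feature i x * feature j x * (ip (feature i) (v q) * ip (feature j) (v q)))"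
        by (rule sum.cong[OF refl], rule sum.swap)
      finally have "ip (r p) (r p) = (\<Sum>i\<in>modes m. \<Sum>j\<in>modes m. feature i x * feature j x *
          (ip (feature i) (feature j) - (\<Sum>q\<in>I. ip (feature i) (v q) * ip (feature j) (v q))))"
        by (simp add: sum_subtractf right_diff_distrib sum_distrib_left)
      also have "\<dots> = Q A"
        unfolding Q_def A_def r_def
        by (intro sum.cong refl) (simp add: ip_resid_resid[OF I] feature_mem mult.commute)
      finally show ?thesis .
    qed
    have "ip_norm ip p \<le> ip_norm ip (k x)"
    proof -
      have "ip p p = (\<Sum>i\<in>modes m. (ip (k x) (feature i))\<^sup>2)"
        using ip_proj_right[OF finite_modes orthonormal_feature pH, of m "k x"]
          ip_proj_basis[OF finite_modes orthonormal_feature, of _ m "k x"]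
        by (simp add: p_def power2_eq_square)
      also have "\<dots> \<le> ip (k x) (k x)" by (rule bessel[OF finite_modes orthonormal_feature kernel_mem])
      finally show ?thesis by (simp add: ip_norm_def)
    qed
    then have "ip_norm ip (r p) \<le> K"
      using resid_norm_le[OF I pH] ip_norm_kernel_le[of x] unfolding r_def by linarith
    \<comment> \<open>At the exact matrix \<open>A\<close> neither the absolute value nor the cap
      changes the value, so the comparison is between two values of the 1-Lipschitz map
      \<open>min K\<close>.\<close>
    then have g_A: "ip_norm ip (r p) = min K (sqrt \<bar>Q A\<bar>)"
      using ip_nonneg[OF rp] by (simp add: Q_A ip_norm_def)
    have "\<bar>sqrt \<bar>Q A\<bar> - sqrt \<bar>Q (\<lambda>i j. real_of_int (t (i, j)) / real G)\<bar>\<bar>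
      \<le> sqrt \<bar>\<bar>Q A\<bar> - \<bar>Q (\<lambda>i j. real_of_int (t (i, j)) / real G)\<bar>\<bar>"
      by (rule abs_sqrt_diff_le) auto
    \<comment> \<open>At most \<open>m^2\<close> entries, each off by at most \<open>1 / G\<close>
      and multiplied by two features bounded by \<open>K\<close>.\<close>
    also have "\<dots> \<le> sqrt ((real m * K)\<^sup>2 / G)"
    proof (rule real_sqrt_le_mono)
      have "\<bar>\<bar>Q A\<bar> - \<bar>Q (\<lambda>i j. real_of_int (t (i, j)) / real G)\<bar>\<bar>
        \<le> \<bar>Q A - Q (\<lambda>i j. real_of_int (t (i, j)) / real G)\<bar>" by (rule abs_triangle_ineq3)
      also have "\<dots> = \<bar>\<Sum>i\<in>modes m. \<Sum>j\<in>modes m.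
          (A i j - real_of_int (t (i, j)) / real G) * (feature i x * feature j x)\<bar>"
        unfolding Q_def by (simp add: sum_subtractf left_diff_distrib)
      also have "\<dots> \<le> (\<Sum>i\<in>modes m. \<Sum>j\<in>modes m.
          \<bar>(A i j - real_of_int (t (i, j)) / real G) * (feature i x * feature j x)\<bar>)"
        by (rule order_trans[OF sum_abs sum_mono[OF sum_abs]])
      also have "\<dots> \<le> (\<Sum>i\<in>modes m. \<Sum>j\<in>modes m. 1 / G * (K * K))"
      proof (intro sum_mono)
        fix i j assume ij: "i \<in> modes m" "j \<in> modes m"
        have "\<bar>real G * A i j - real_of_int (t (i, j))\<bar> \<le> 1" using ij by (simp add: t_def) linarith
        moreover have "A i j - real_of_int (t (i, j)) / real G
            = (real G * A i j - real_of_int (t (i, j))) / real G"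
          using G by (simp add: diff_divide_distrib)
        ultimately have "\<bar>A i j - real_of_int (t (i, j)) / real G\<bar> \<le> 1 / real G"
          using G by (simp add: abs_divide divide_right_mono)
        moreover have "\<bar>feature i x * feature j x\<bar> \<le> K * K"
          unfolding abs_mult using feature_le ij K_ge_1 by (intro mult_mono) auto
        ultimately show "\<bar>(A i j - real_of_int (t (i, j)) / real G) * (feature i x * feature j x)\<bar>
            \<le> 1 / G * (K * K)"
          unfolding abs_mult[of "A i j - _"] using K_ge_1 by (intro mult_mono) auto
      qed
      also have "\<dots> = real (card (modes m) * card (modes m)) * (1 / G * (K * K))" by simp
      also have "\<dots> \<le> real (m * m) * (1 / G * (K * K))"
        using card_modes[of m] K_ge_1 by (intro mult_right_mono of_nat_mono mult_le_mono) auto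
      also have "\<dots> = (real m * K)\<^sup>2 / G" by (simp add: power2_eq_square)
      finally show "\<bar>\<bar>Q A\<bar> - \<bar>Q (\<lambda>i j. real_of_int (t (i, j)) / real G)\<bar>\<bar> \<le> (real m * K)\<^sup>2 / G" .
    qed
    also have "\<dots> = real m * K / sqrt G" using K_ge_1 by (simp add: real_sqrt_divide)
    finally have "\<bar>sqrt \<bar>Q A\<bar> - sqrt \<bar>Q (\<lambda>i j. real_of_int (t (i, j)) / real G)\<bar>\<bar> \<le> real m * K / sqrt G" .
    moreover have "grid_function m G t x = min K (sqrt \<bar>Q (\<lambda>i j. real_of_int (t (i, j)) / real G)\<bar>)"
      by (simp add: grid_function_def Q_def)
    ultimately have 1: "\<bar>ip_norm ip (r p) - grid_function m G t x\<bar> \<le> real m * K / sqrt G"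
      unfolding g_A by (simp add: min_def) linarith
    \<comment> \<open>\<open>k x - p\<close> is the residual off the features, whose norm is the
      root of the truncation error, and \<open>r\<close> does not increase norms.\<close>
    have "ip_norm ip (\<lambda>y. r (k x) y - r p y) \<le> sqrt (truncation_error m x)"
    proof -
      have "(\<lambda>y. r (k x) y - r p y) = r (\<lambda>y. k x y - p y)"
        unfolding r_def by (rule resid_diff[OF I kernel_mem pH, symmetric])
      also have "(\<lambda>y. k x y - p y) = resid (modes m) feature (k x)"
        by (simp add: resid_def[abs_def] p_def)
      finally show ?thesis
        unfolding truncation_error_eq_norm r_def
        using resid_norm_le[OF I resid_mem[OF finite_modes orthonormal_feature kernel_mem]] by simp
    qed
    moreover have "ip_norm ip (r (k x)) \<le> ip_norm ip (r p) + ip_norm ip (\<lambda>y. r (k x) y - r p y)"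
      by (rule ip_norm_triangle[OF rk rp])
    moreover have "ip_norm ip (r p) \<le> ip_norm ip (r (k x)) + ip_norm ip (\<lambda>y. r (k x) y - r p y)"
      using ip_norm_triangle[OF rp rk] ip_norm_diff_commute[OF rp rk] by simp
    ultimately show ?thesis using 1 by linarith
  qed
  ultimately show ?thesis unfolding r_def by blast
qed

section \<open>Bounds, integrability and expectation of the Nystroem residual\<close>

lemma nystroem_residual_bounds:
  assumes dec: "ordered_eigendecomposition l (\<lambda>i j. k (Z i) (Z j)) U lam" and s: "1 \<le> s" "s \<le> l"
  shows "0 \<le> k x x - nystroem k l Z U lam s x x" "k x x - nystroem k l Z U lam s x x \<le> K"
    "(\<lambda>x. k x x - nystroem k l Z U lam s x x) \<in> borel_measurable M"
proof -
  obtain I v where "finite (I :: nat set)" "orthonormal_on I v"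
    and eq: "\<forall>x. k x x - nystroem k l Z U lam s x x = (ip_norm ip (resid I v (k x)))\<^sup>2"
    by (rule nystroem_diag[OF dec s finite_modes orthonormal_feature card_modes])
  show "0 \<le> k x x - nystroem k l Z U lam s x x" unfolding eq[rule_format] by simp
  have "0 \<le> nystroem k l Z U lam s x x"
    unfolding nystroem_def by (intro sum_nonneg) (simp add: mult.assoc)
  then show "k x x - nystroem k l Z U lam s x x \<le> K" using kernel_le[of x] by linarith
  have [measurable]: "k y \<in> borel_measurable M" for y by (rule rkhs_measurable[OF kernel_mem])
  note kernel_diag_measurable[measurable]
  show "(\<lambda>x. k x x - nystroem k l Z U lam s x x) \<in> borel_measurable M"
    unfolding nystroem_def by measurable
qed

lemma nystroem_residual_integrable:
  assumes dec: "ordered_eigendecomposition l (\<lambda>i j. k (Z i) (Z j)) U lam" and s: "1 \<le> s" "s \<le> l"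
  shows "integrable M (\<lambda>x. k x x - nystroem k l Z U lam s x x)"
    "integrable M (\<lambda>x. sqrt (k x x - nystroem k l Z U lam s x x))"
proof -
  note b = nystroem_residual_bounds[OF assms]
  show "integrable M (\<lambda>x. k x x - nystroem k l Z U lam s x x)"
    using b by (intro integrable_const_bound[of _ K]) auto
  show "integrable M (\<lambda>x. sqrt (k x x - nystroem k l Z U lam s x x))"
    using b sqrt_le_K by (intro integrable_const_bound[of _ K] borel_measurable_sqrt) auto
qed

text \<open>Values \<open>a\<close> in \<open>[0, K]\<close> satisfy \<open>sqrt a \<le> K\<close>,
  hence \<open>a \<le> K * sqrt a\<close>; thus the estimate without the root follows from the one
  with it.\<close>

lemma nystroem_residual_le_sqrt:
  assumes dec: "ordered_eigendecomposition l (\<lambda>i j. k (Z i) (Z j)) U lam" and s: "1 \<le> s" "s \<le> l"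
  shows "(\<integral>x. (k x x - nystroem k l Z U lam s x x) \<partial>M)
    \<le> K * (\<integral>x. sqrt (k x x - nystroem k l Z U lam s x x) \<partial>M)"
proof -
  note b = nystroem_residual_bounds[OF assms]
  note i = nystroem_residual_integrable[OF assms]
  have "(\<integral>x. (k x x - nystroem k l Z U lam s x x) \<partial>M)
    \<le> (\<integral>x. K * sqrt (k x x - nystroem k l Z U lam s x x) \<partial>M)"
  proof (intro integral_mono i integrable_mult_right)
    fix x
    let ?a = "k x x - nystroem k l Z U lam s x x"
    have "?a = sqrt ?a * sqrt ?a" using b(1)[of x] by simp
    also have "\<dots> \<le> K * sqrt ?a" using b(1)[of x] sqrt_le_K[OF b(2)[of x]] by (intro mult_right_mono) auto
    finally show "?a \<le> K * sqrt ?a" .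
  qed
  then show ?thesis by simp
qed

text \<open>The majorant \<open>B\<close> depends on the sample alone, so its integrability is
  independent of how \<open>U\<close> and \<open>lam\<close> are selected. \<open>m\<close> and
  \<open>G\<close> stay free for later optimization.\<close>

lemma nystroem_expectation_bound:
  fixes l s m G :: nat
  defines "P \<equiv> PiM {1..l} (\<lambda>_. M)"
  assumes s: "1 \<le> s" "s \<le> l" and G: "0 < G"
  obtains B where "integrable P B"
    "(\<integral>Z. B Z \<partial>P) \<le> 2 * sqrt (tail s) + 3 * sqrt (tail m) + 3 * (real m * K / sqrt G)
      + 2 * K * (real m ^ 2 * ln (2 * real G + 1)) / l"
    "\<And>Z U lam. ordered_eigendecomposition l (\<lambda>i j. k (Z i) (Z j)) U lam \<Longrightarrow>
      (\<integral>x. sqrt (k x x - nystroem k l Z U lam s x x) \<partial>M) \<le> B Z"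
proof -
  have l: "0 < l" using s by simp
  interpret P: prob_space P unfolding P_def by (rule prob_space_PiM_const)
  define \<eta> where "\<eta> = real m * K / sqrt G"
  let ?g = "grid_function m G"
  let ?\<rho> = "\<lambda>x. sqrt (truncation_error m x)"
  obtain D where D: "integrable P D" "(\<integral>Z. D Z \<partial>P) \<le> 2 * K * ln (card (grid m G)) / l"
    "\<And>t Z. t \<in> grid m G \<Longrightarrow> integral\<^sup>L M (?g t) \<le> 2 / l * (\<Sum>j=1..l. ?g t (Z j)) + D Z"
  proof (rule uniform_deviation[OF finite_grid[of m G] grid_nonempty[of m G], of ?g K l])
    show "0 < K" using K_ge_1 by simp
    fix D assume "integrable (PiM {1..l} (\<lambda>_. M)) D"
      "(\<integral>Z. D Z \<partial>PiM {1..l} (\<lambda>_. M)) \<le> 2 * K * ln (card (grid m G)) / l"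
      "\<And>t Z. t \<in> grid m G \<Longrightarrow> integral\<^sup>L M (?g t) \<le> 2 / l * (\<Sum>j=1..l. ?g t (Z j)) + D Z"
    then show thesis unfolding P_def[symmetric] by (rule that)
  qed (auto simp: grid_function_measurable grid_function_bounds l)
  define E where "E Z = sqrt ((\<Sum>j=1..l. truncation_error s (Z j)) / l)" for Z :: "nat \<Rightarrow> 'a"
  have E: "integrable P E" "(\<integral>Z. E Z \<partial>P) \<le> sqrt (tail s)"
    using expectation_sqrt_mean_le[OF truncation_error_integrable[of s] truncation_error_nonneg l]
    unfolding E_def[abs_def] P_def by (simp_all add: integral_truncation_error)
  define R where "R Z = (\<Sum>j=1..l. ?\<rho> (Z j))" for Z :: "nat \<Rightarrow> 'a"
  note \<rho>i = sqrt_truncation_error_integrable[of m]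
  have \<rho>: "integrable P (\<lambda>Z. ?\<rho> (Z j))" "(\<integral>Z. ?\<rho> (Z j) \<partial>P) = integral\<^sup>L M ?\<rho>" if "j \<in> {1..l}" for j
    unfolding P_def using integral_PiM_coordinate[OF that borel_measurable_integrable[OF \<rho>i]] \<rho>i by blast+
  have R: "integrable P R" "(\<integral>Z. R Z \<partial>P) = l * integral\<^sup>L M ?\<rho>"
  proof -
    show "integrable P R" unfolding R_def[abs_def] by (intro Bochner_Integration.integrable_sum \<rho>(1))
    have "(\<integral>Z. R Z \<partial>P) = (\<Sum>j=1..l. \<integral>Z. ?\<rho> (Z j) \<partial>P)"
      unfolding R_def by (intro Bochner_Integration.integral_sum \<rho>(1))
    also have "\<dots> = (\<Sum>j=1..l. integral\<^sup>L M ?\<rho>)" by (intro sum.cong refl \<rho>(2))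
    finally show "(\<integral>Z. R Z \<partial>P) = l * integral\<^sup>L M ?\<rho>" by simp
  qed
  \<comment> \<open>\<open>E\<close> and \<open>R\<close> carry the factor 2 of the deviation
    inequality. Truncation and rounding are each paid once under \<open>M\<close> and twice on the
    sample, hence the threes in the final bound.\<close>
  define B where "B Z = 2 * E Z + 2 / l * R Z + D Z + (sqrt (tail m) + 3 * \<eta>)" for Z
  show ?thesis
  proof
    show "integrable P B" unfolding B_def[abs_def] using E(1) R(1) D(1) by simp
    have "(\<integral>Z. B Z \<partial>P) = 2 * (\<integral>Z. E Z \<partial>P) + 2 / l * (\<integral>Z. R Z \<partial>P) + (\<integral>Z. D Z \<partial>P) + (sqrt (tail m) + 3 * \<eta>)"
      unfolding B_def using E(1) R(1) D(1) by (simp add: P.prob_space)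
    also have "\<dots> \<le> 2 * sqrt (tail s) + 2 * sqrt (tail m) + 2 * K * (real m ^ 2 * ln (2 * real G + 1)) / l
      + (sqrt (tail m) + 3 * \<eta>)"
    proof (intro add_mono order_refl)
      show "2 * (\<integral>Z. E Z \<partial>P) \<le> 2 * sqrt (tail s)" using E(2) by simp
      show "2 / l * (\<integral>Z. R Z \<partial>P) \<le> 2 * sqrt (tail m)"
        using R(2) l integral_sqrt_truncation_error_le[of m] by simp
      have "2 * K * ln (card (grid m G)) / l \<le> 2 * K * (real m ^ 2 * ln (2 * real G + 1)) / l"
        using ln_card_grid_le[of m G] K_ge_1 by (intro divide_right_mono mult_left_mono) auto
      then show "(\<integral>Z. D Z \<partial>P) \<le> 2 * K * (real m ^ 2 * ln (2 * real G + 1)) / l"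
        using D(2) by (rule order_trans[rotated])
    qed
    finally show "(\<integral>Z. B Z \<partial>P) \<le> 2 * sqrt (tail s) + 3 * sqrt (tail m) + 3 * (real m * K / sqrt G)
      + 2 * K * (real m ^ 2 * ln (2 * real G + 1)) / l"
      by (simp add: \<eta>_def)
    fix Z :: "nat \<Rightarrow> 'a" and U lam
    assume dec: "ordered_eigendecomposition l (\<lambda>i j. k (Z i) (Z j)) U lam"
    define f where "f x = sqrt (k x x - nystroem k l Z U lam s x x)" for x
    obtain I v where I: "finite (I :: nat set)" "orthonormal_on I v"
      and diag: "\<forall>x. k x x - nystroem k l Z U lam s x x = (ip_norm ip (resid I v (k x)))\<^sup>2"
      and emp: "(\<Sum>j=1..l. k (Z j) (Z j) - nystroem k l Z U lam s (Z j) (Z j))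
        \<le> (\<Sum>j=1..l. k (Z j) (Z j) - (\<Sum>i\<in>modes s. (feature i (Z j))\<^sup>2))"
      by (rule nystroem_diag[OF dec s finite_modes orthonormal_feature card_modes])
    have f: "f x = ip_norm ip (resid I v (k x))" for x
      using ip_norm_nonneg[OF resid_mem[OF I kernel_mem]] by (simp add: f_def diag)
    \<comment> \<open>\<open>t\<close> depends on the sample through \<open>I\<close> and
      \<open>v\<close>, which the bound uniform over the grid permits.\<close>
    obtain t where t: "t \<in> grid m G" and "\<forall>x. \<bar>f x - ?g t x\<bar> \<le> ?\<rho> x + \<eta>"
      using grid_approximation[OF I G, of m] unfolding f \<eta>_def by blast
    then have near: "\<bar>f x - ?g t x\<bar> \<le> ?\<rho> x + \<eta>" for x by blast
    have fi: "integrable M f"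
      unfolding f_def[abs_def] by (rule nystroem_residual_integrable[OF dec s])
    have gi: "integrable M (?g t)"
      using grid_function_bounds[of m G t]
      by (intro integrable_const_bound[of _ K] grid_function_measurable) auto
    have "integral\<^sup>L M f \<le> (\<integral>x. ?g t x + ?\<rho> x + \<eta> \<partial>M)"
    proof (intro integral_mono fi)
      show "integrable M (\<lambda>x. ?g t x + ?\<rho> x + \<eta>)"
        using gi sqrt_truncation_error_integrable[of m] by simp
      show "f x \<le> ?g t x + ?\<rho> x + \<eta>" for x using near[of x] by linarith
    qed
    also have "\<dots> = integral\<^sup>L M (?g t) + integral\<^sup>L M ?\<rho> + \<eta>"
      using gi sqrt_truncation_error_integrable[of m] by (simp add: prob_space)
    finally have 1: "integral\<^sup>L M f \<le> 2 / l * (\<Sum>j=1..l. ?g t (Z j)) + D Z + sqrt (tail m) + \<eta>"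
      using D(3)[OF t, of Z] integral_sqrt_truncation_error_le[of m] by linarith
    have "(\<Sum>j=1..l. ?g t (Z j)) \<le> (\<Sum>j=1..l. f (Z j) + ?\<rho> (Z j) + \<eta>)"
    proof (rule sum_mono)
      fix j show "?g t (Z j) \<le> f (Z j) + ?\<rho> (Z j) + \<eta>" using near[of "Z j"] by linarith
    qed
    also have "\<dots> = (\<Sum>j=1..l. f (Z j)) + R Z + l * \<eta>" by (simp add: sum.distrib R_def)
    finally have "2 / l * (\<Sum>j=1..l. ?g t (Z j)) \<le> 2 / l * ((\<Sum>j=1..l. f (Z j)) + R Z + l * \<eta>)"
      by (intro mult_left_mono) auto
    also have "\<dots> = 2 * ((\<Sum>j=1..l. f (Z j)) / l) + 2 / l * R Z + 2 * \<eta>"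
      using l by (simp add: field_simps)
    finally have 2: "2 / l * (\<Sum>j=1..l. ?g t (Z j)) \<le> 2 * ((\<Sum>j=1..l. f (Z j)) / l) + 2 / l * R Z + 2 * \<eta>" .
    \<comment> \<open>Cauchy-Schwarz passes from the mean of \<open>f\<close> to the mean of its
      square, where optimality of the principal directions applies.\<close>
    have 3: "(\<Sum>j=1..l. f (Z j)) / l \<le> E Z"
      unfolding E_def
    proof (rule real_le_rsqrt)
      have "(\<Sum>j=1..l. f (Z j))\<^sup>2 \<le> (\<Sum>j=1..l. (f (Z j))\<^sup>2) * card {1..l}"
        by (rule sum_squared_le_sum_of_squares)
      also have "(\<Sum>j=1..l. (f (Z j))\<^sup>2) = (\<Sum>j=1..l. k (Z j) (Z j) - nystroem k l Z U lam s (Z j) (Z j))"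
        by (simp add: f diag)
      also have "\<dots> * card {1..l} \<le> (\<Sum>j=1..l. truncation_error s (Z j)) * card {1..l}"
        using emp by (intro mult_right_mono) (auto simp: truncation_error_def)
      finally have "(\<Sum>j=1..l. f (Z j))\<^sup>2 \<le> (\<Sum>j=1..l. truncation_error s (Z j)) * l" by simp
      then have "(\<Sum>j=1..l. f (Z j))\<^sup>2 / (real l)\<^sup>2 \<le> (\<Sum>j=1..l. truncation_error s (Z j)) * l / (real l)\<^sup>2"
        by (rule divide_right_mono) simp
      then show "((\<Sum>j=1..l. f (Z j)) / l)\<^sup>2 \<le> (\<Sum>j=1..l. truncation_error s (Z j)) / l"
        using l by (simp add: power_divide power2_eq_square[of "real l"])
    qed
    have "integral\<^sup>L M f \<le> B Z" using 1 2 3 unfolding B_def by linarith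
    then show "(\<integral>x. sqrt (k x x - nystroem k l Z U lam s x x) \<partial>M) \<le> B Z"
      by (simp add: f_def[abs_def])
  qed
qed

end

section \<open>Truncation parameters under exponential decay\<close>

lemma power_div_fact_le_exp:
  fixes y :: real
  assumes "0 \<le> y"
  shows "y ^ n / fact n \<le> exp y"
proof -
  have "sum (\<lambda>i. y ^ i /\<^sub>R fact i) {n} \<le> (\<Sum>i. y ^ i /\<^sub>R fact i)"
    by (rule sum_le_suminf[OF summable_exp_generic]) (use assms in auto)
  then show ?thesis by (simp add: exp_def divide_inverse mult.commute)
qed

text \<open>The Taylor term of degree \<open>2 * d\<close> turns the root into \<open>i^2\<close>,
  so the bound is summable in \<open>i\<close>.\<close>

lemma exp_neg_root_le:
  fixes b :: real
  assumes b: "0 < b" and d: "0 < d" and i: "1 \<le> i"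
  shows "exp (- b * real i powr (1 / real d)) \<le> fact (2 * d) / b ^ (2 * d) * inverse (real i ^ 2)"
proof -
  define y where "y = b * real i powr (1 / real d)"
  have y: "0 < y" using b i by (simp add: y_def)
  have "(real i powr (1 / real d)) ^ d = real i"
    using i d by (simp add: powr_realpow[symmetric] powr_powr)
  then have "(real i powr (1 / real d)) ^ (2 * d) = real i ^ 2"
    by (simp add: power_mult mult.commute[of 2])
  then have yp: "y ^ (2 * d) = b ^ (2 * d) * real i ^ 2" by (simp add: y_def power_mult_distrib)
  have "y ^ (2 * d) / fact (2 * d) \<le> exp y" by (rule power_div_fact_le_exp) (use y in simp)
  then have "inverse (exp y) \<le> inverse (y ^ (2 * d) / fact (2 * d))"
    using y by (intro le_imp_inverse_le) auto
  then have "exp (- y) \<le> fact (2 * d) / (b ^ (2 * d) * real i ^ 2)"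
    by (simp only: exp_minus inverse_divide yp)
  also have "\<dots> = fact (2 * d) / b ^ (2 * d) * inverse (real i ^ 2)"
    by (simp only: divide_inverse inverse_mult_distrib mult.assoc)
  finally show ?thesis by (simp add: y_def)
qed

text \<open>The exponential is split into two equal factors: one is monotone and yields the rate
  \<open>\<beta> / 2\<close> in \<open>m\<close>, the other is traded for a summable inverse
  square.\<close>

lemma exponential_decay_tail:
  fixes \<sigma> :: "nat \<Rightarrow> real"
  assumes \<beta>: "0 < \<beta>" and d: "0 < d" and C: "0 < C"
    and decay: "\<And>i. 1 \<le> i \<Longrightarrow> \<sigma> i \<le> C * exp (- \<beta> * real i powr (1 / real d))"
    and nonneg: "\<And>i. 1 \<le> i \<Longrightarrow> 0 \<le> \<sigma> i"
  shows "summable (\<lambda>i. \<sigma> (Suc i))"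
    and "\<exists>S\<ge>0. \<forall>m. eigenvalue_tail \<sigma> m \<le> S * exp (- (\<beta> / 2) * real m powr (1 / real d))"
proof -
  define c where "c = fact (2 * d) / (\<beta> / 2) ^ (2 * d)"
  have c: "0 < c" using \<beta> by (simp add: c_def)
  define q where "q i = inverse (real (Suc i) ^ 2)" for i
  have q: "summable q"
    unfolding q_def using inverse_power_summable[of 2, where 'a = real] by (subst summable_Suc_iff) simp
  have le: "\<sigma> (Suc (i + m)) \<le> C * c * exp (- (\<beta> / 2) * real m powr (1 / real d)) * q i" for i m
  proof -
    let ?y = "real (Suc (i + m)) powr (1 / real d)"
    have "\<sigma> (Suc (i + m)) \<le> C * exp (- \<beta> * ?y)" by (rule decay) simp
    also have "exp (- \<beta> * ?y) = exp (- (\<beta> / 2) * ?y) * exp (- (\<beta> / 2) * ?y)"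
      by (simp add: exp_add[symmetric])
    also have "C * \<dots> \<le> C * (exp (- (\<beta> / 2) * real m powr (1 / real d)) * (c * q i))"
    proof (intro mult_left_mono mult_mono)
      have "real m powr (1 / real d) \<le> ?y" by (intro powr_mono2) auto
      then show "exp (- (\<beta> / 2) * ?y) \<le> exp (- (\<beta> / 2) * real m powr (1 / real d))" using \<beta> by simp
      have "exp (- (\<beta> / 2) * ?y) \<le> c * inverse (real (Suc (i + m)) ^ 2)"
        unfolding c_def using \<beta> d by (intro exp_neg_root_le) auto
      also have "\<dots> \<le> c * q i"
        unfolding q_def using c by (intro mult_left_mono le_imp_inverse_le power_mono) auto
      finally show "exp (- (\<beta> / 2) * ?y) \<le> c * q i" .
    qed (use C in auto)
    finally show ?thesis by (simp add: mult_ac)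
  qed
  show sm: "summable (\<lambda>i. \<sigma> (Suc i))"
  proof (rule summable_comparison_test)
    show "summable (\<lambda>i. C * c * exp (- (\<beta> / 2) * real 0 powr (1 / real d)) * q i)"
      by (intro summable_mult q)
    show "\<exists>N. \<forall>n\<ge>N. norm (\<sigma> (Suc n)) \<le> C * c * exp (- (\<beta> / 2) * real 0 powr (1 / real d)) * q n"
      using le[of _ 0] nonneg by (intro exI[of _ 0]) simp
  qed
  show "\<exists>S\<ge>0. \<forall>m. eigenvalue_tail \<sigma> m \<le> S * exp (- (\<beta> / 2) * real m powr (1 / real d))"
  proof (intro exI[of _ "C * c * suminf q"] conjI allI)
    show "0 \<le> C * c * suminf q" using C c q by (intro mult_nonneg_nonneg suminf_nonneg) (auto simp: q_def)
    fix m
    have t: "(\<lambda>i. \<sigma> (Suc (i + m))) sums eigenvalue_tail \<sigma> m" by (rule eigenvalue_tail_sums[OF sm nonneg])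
    have "(\<lambda>i. C * c * exp (- (\<beta> / 2) * real m powr (1 / real d)) * q i) sums
      (C * c * exp (- (\<beta> / 2) * real m powr (1 / real d)) * suminf q)"
      using q by (intro sums_mult) (rule summable_sums)
    then have "eigenvalue_tail \<sigma> m \<le> C * c * exp (- (\<beta> / 2) * real m powr (1 / real d)) * suminf q"
      by (rule sums_le[OF le t])
    then show "eigenvalue_tail \<sigma> m \<le> C * c * suminf q * exp (- (\<beta> / 2) * real m powr (1 / real d))"
      by (simp add: mult_ac)
  qed
qed

text \<open>Since \<open>exp 1 \<le> 3\<close>, constants can be absorbed into powers of
  \<open>ln l\<close> from \<open>l = 3\<close> on.\<close>

lemma one_le_ln: "3 \<le> l \<Longrightarrow> 1 \<le> ln (real l)"
  using exp_le by (subst ln_ge_iff) auto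

text \<open>With \<open>m\<close> of order \<open>(ln l)^d\<close> and \<open>G\<close> of size
  \<open>(m N l)^2\<close>, the entropy term has order \<open>(ln l)^(2 d + 1) / l\<close>, while
  truncation and rounding cost \<open>O(1 / l)\<close>.\<close>

lemma truncation_parameters:
  fixes \<sigma> :: "nat \<Rightarrow> real" and K :: real
  assumes \<beta>: "0 < \<beta>" and d: "0 < d" and K: "1 \<le> K" and S: "0 \<le> S"
    and tail: "\<And>m. eigenvalue_tail \<sigma> m \<le> S * exp (- (\<beta> / 2) * real m powr (1 / real d))"
  shows "\<exists>A\<ge>0. \<forall>l\<ge>3. \<exists>m G. 0 < G \<and>
    3 * sqrt (eigenvalue_tail \<sigma> m) + 3 * (real m * K / sqrt (real G))
      + 2 * K * (real m ^ 2 * ln (2 * real G + 1)) / real l \<le> A * (ln (real l) ^ (2 * d + 1) / real l)"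
proof -
  \<comment> \<open>The summand 1 absorbs the ceiling in \<open>m\<close>, since
    \<open>1 \<le> L ^ d\<close>.\<close>
  define c1 where "c1 = (4 / \<beta>) ^ d + 1"
  \<comment> \<open>An integer above \<open>K\<close>, so that \<open>G\<close> can be a natural
    number that outweighs the factor \<open>K\<close> in the rounding error.\<close>
  define N where "N = nat \<lceil>K\<rceil>"
  have N: "1 \<le> N" "K \<le> real N" using K by (auto simp: N_def le_nat_iff)
  have c1: "1 \<le> c1" using \<beta> by (simp add: c1_def)
  \<comment> \<open>Collects the terms of \<open>ln (3 * G)\<close>, each at most a multiple of
    \<open>L\<close>.\<close>
  define c2 where "c2 = ln 3 + 2 * (ln c1 + real d) + 2 * ln (real N) + 2"
  have c2: "0 \<le> c2" using c1 N by (simp add: c2_def)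
  define A where "A = 3 * sqrt S + 3 + 2 * K * (c1 ^ 2 * c2)"
  show ?thesis
  proof (intro exI[of _ A] conjI allI impI)
    show "0 \<le> A" using S K c2 by (simp add: A_def)
    fix l :: nat assume l3: "3 \<le> l"
    define L where "L = ln (real l)"
    have L: "1 \<le> L" unfolding L_def by (rule one_le_ln[OF l3])
    \<comment> \<open>This makes \<open>(\<beta> / 2) * a = 2 * L\<close>, so the tail is at most
      \<open>S / l^2\<close> and its root at most \<open>sqrt S / l\<close>.\<close>
    define a where "a = 4 / \<beta> * L"
    have a: "0 < a" using \<beta> L by (simp add: a_def)
    define m where "m = nat \<lceil>a ^ d\<rceil>"
    have ad: "0 < a ^ d" using a by simp
    have m_ge: "a ^ d \<le> real m" unfolding m_def by (rule real_nat_ceiling_ge)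
    have m1: "1 \<le> m" using ad m_ge by (cases m) auto
    have "real m \<le> a ^ d + 1" using ad by (simp add: m_def)
    also have "\<dots> \<le> (4 / \<beta>) ^ d * L ^ d + L ^ d"
      unfolding a_def power_mult_distrib using one_le_power[OF L, of d] by simp
    finally have m_le: "real m \<le> c1 * L ^ d" by (simp add: c1_def algebra_simps)
    have tail_m: "sqrt (eigenvalue_tail \<sigma> m) \<le> sqrt S / l"
    proof -
      have "a = (a ^ d) powr (1 / real d)"
        using a d by (simp add: powr_realpow[symmetric] powr_powr)
      also have "\<dots> \<le> real m powr (1 / real d)" using m_ge ad by (intro powr_mono2) auto
      finally have "- (\<beta> / 2) * real m powr (1 / real d) \<le> - (\<beta> / 2) * a"
        using \<beta> by (intro mult_left_mono_neg) auto
      also have "\<dots> = - (2 * L)" using \<beta> by (simp add: a_def)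
      finally have "exp (- (\<beta> / 2) * real m powr (1 / real d)) \<le> exp (- (2 * L))" by simp
      also have "\<dots> = 1 / (real l)\<^sup>2"
        using l3 by (simp add: L_def exp_minus exp_double divide_inverse)
      finally have "eigenvalue_tail \<sigma> m \<le> S * (1 / (real l)\<^sup>2)"
        using tail[of m] S by (meson mult_left_mono order_trans)
      then have "sqrt (eigenvalue_tail \<sigma> m) \<le> sqrt (S / (real l)\<^sup>2)" by (intro real_sqrt_le_mono) simp
      then show ?thesis by (simp add: real_sqrt_divide)
    qed
    define G where "G = (m * N * l) ^ 2"
    have G: "0 < G" using m1 N l3 by (simp add: G_def)
    have "sqrt (real G) = real m * real N * real l" by (simp add: G_def)
    then have "real m * K / sqrt (real G) = K / real N / real l" using m1 by simp
    also have "\<dots> \<le> 1 / real l" using N K by (intro divide_right_mono) auto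
    finally have eta: "real m * K / sqrt (real G) \<le> 1 / real l" .
    have lnm: "ln (real m) \<le> (ln c1 + real d) * L"
    proof -
      have "ln (real m) \<le> ln (c1 * L ^ d)" using m1 m_le by (subst ln_le_cancel_iff) auto
      also have "\<dots> = ln c1 + real d * ln L" using c1 L by (simp add: ln_mult ln_realpow)
      also have "\<dots> \<le> ln c1 * L + real d * L"
        using L c1 ln_le_minus_one[of L] mult_left_mono[of 1 L "ln c1"]
        by (intro add_mono mult_left_mono) auto
      finally show ?thesis by (simp add: distrib_right)
    qed
    have "ln (2 * real G + 1) \<le> ln (3 * real G)" using G by simp
    also have "\<dots> = ln 3 + 2 * (ln (real m) + ln (real N) + ln (real l))"
      using m1 N l3 by (simp add: G_def ln_mult ln_realpow)
    also have "\<dots> \<le> ln 3 * L + 2 * ((ln c1 + real d) * L + ln (real N) * L + L)"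
      using lnm L N mult_left_mono[of 1 L "ln 3"] mult_left_mono[of 1 L "ln (real N)"]
      by (intro add_mono mult_left_mono) (auto simp: L_def)
    also have "\<dots> = c2 * L" by (simp add: c2_def algebra_simps)
    finally have lnG: "ln (2 * real G + 1) \<le> c2 * L" .
    have "real m ^ 2 * ln (2 * real G + 1) \<le> (c1 * L ^ d) ^ 2 * (c2 * L)"
      using m_le lnG by (intro mult_mono power_mono) auto
    also have "\<dots> = c1 ^ 2 * c2 * L ^ (2 * d + 1)"
      by (simp add: power_mult_distrib power_mult[symmetric] mult_ac)
    finally have ent: "real m ^ 2 * ln (2 * real G + 1) \<le> c1 ^ 2 * c2 * L ^ (2 * d + 1)" .
    have L1: "1 \<le> L ^ (2 * d + 1)" by (rule one_le_power[OF L])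
    have "3 * sqrt (eigenvalue_tail \<sigma> m) + 3 * (real m * K / sqrt (real G))
        + 2 * K * (real m ^ 2 * ln (2 * real G + 1)) / real l
      \<le> 3 * (sqrt S / l) + 3 * (1 / real l) + 2 * K * (c1 ^ 2 * c2 * L ^ (2 * d + 1)) / real l"
      using tail_m eta ent K by (intro add_mono mult_left_mono divide_right_mono) auto
    also have "\<dots> = (3 * sqrt S * 1 + 3 * 1 + 2 * K * (c1 ^ 2 * c2) * L ^ (2 * d + 1)) / real l"
      by (simp add: add_divide_distrib)
    also have "\<dots> \<le> (3 * sqrt S * L ^ (2 * d + 1) + 3 * L ^ (2 * d + 1)
        + 2 * K * (c1 ^ 2 * c2) * L ^ (2 * d + 1)) / real l"
      using L1 S by (intro divide_right_mono add_right_mono add_mono mult_left_mono[OF L1]) auto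
    also have "\<dots> = A * (L ^ (2 * d + 1) / real l)"
      unfolding A_def by (simp only: times_divide_eq_right distrib_right)
    finally show "\<exists>m G. 0 < G \<and>
      3 * sqrt (eigenvalue_tail \<sigma> m) + 3 * (real m * K / sqrt (real G))
        + 2 * K * (real m ^ 2 * ln (2 * real G + 1)) / real l \<le> A * (ln (real l) ^ (2 * d + 1) / real l)"
      using G unfolding L_def by blast
  qed
qed

text \<open>Both Nystroem estimates come from one majorant \<open>B\<close> and the rule from one
  fixed choice of nodes and weights; it remains to collect constants that do not depend on
  \<open>l\<close> and \<open>s\<close>.\<close>

theorem mainTheorem3:
  fixes M :: "'a :: t2_space measure"
    and k :: "'a \<Rightarrow> 'a \<Rightarrow> real"
    and H :: "('a \<Rightarrow> real) set"
    and ip :: "('a \<Rightarrow> real) \<Rightarrow> ('a \<Rightarrow> real) \<Rightarrow> real"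
    and \<sigma> :: "nat \<Rightarrow> real"
    and e :: "nat \<Rightarrow> 'a \<Rightarrow> real"
    and \<beta> C :: real
    and d :: nat
  assumes "prob_space M" and "sets M = sets borel"
    and "pos_def_kernel k" and "bdd_above (range (\<lambda>x. k x x))"
    and "rkhs k H ip"
    and "ordered_eigenpairs M k \<sigma> e"
    and "\<And>x y. (\<lambda>i. \<sigma> (Suc i) * e (Suc i) x * e (Suc i) y) sums k x y"
    and "orthonormal_basis_of H ip {i. 1 \<le> i \<and> 0 < \<sigma> i} (\<lambda>i x. sqrt (\<sigma> i) * e i x)"
    and "0 < \<beta>" and "0 < d" and "0 < C"
    and "\<And>i. 1 \<le> i \<Longrightarrow> \<sigma> i \<le> C * exp (- \<beta> * real i powr (1 / real d))"
  shows "\<exists>A. \<forall>l s. 3 \<le> l \<and> 1 \<le> s \<and> s \<le> l \<longrightarrow>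
    (let P = PiM {1..l} (\<lambda>_. M);
         bound = A * (sqrt (\<Sum>\<^sub>\<infinity>i\<in>{s<..}. \<sigma> i) + (ln (real l)) ^ (2 * d + 1) / real l)
     in
       (\<forall>U lam.
          (\<forall>Z\<in>space P. ordered_eigendecomposition l (\<lambda>i j. k (Z i) (Z j)) (U Z) (lam Z)) \<and>
          (\<lambda>(Z, x). nystroem k l Z (U Z) (lam Z) s x x) \<in> borel_measurable (P \<Otimes>\<^sub>M M)
          \<longrightarrow>
          integrable P (\<lambda>Z. \<integral>x. sqrt (k x x - nystroem k l Z (U Z) (lam Z) s x x) \<partial>M) \<and>
          (\<integral>Z. (\<integral>x. sqrt (k x x - nystroem k l Z (U Z) (lam Z) s x x) \<partial>M) \<partial>P) \<le> bound \<and>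
          integrable P (\<lambda>Z. \<integral>x. (k x x - nystroem k l Z (U Z) (lam Z) s x x) \<partial>M) \<and>
          (\<integral>Z. (\<integral>x. (k x x - nystroem k l Z (U Z) (lam Z) s x x) \<partial>M) \<partial>P) \<le> bound) \<and>
       (\<exists>(w :: (nat \<Rightarrow> 'a) \<Rightarrow> nat \<Rightarrow> real) (X :: (nat \<Rightarrow> 'a) \<Rightarrow> nat \<Rightarrow> 'a).
          (\<forall>Z\<in>space P. convex_weights (s + 1) (w Z)) \<and>
          (\<forall>i\<in>{1..s + 1}. (\<lambda>Z. w Z i) \<in> borel_measurable P \<and> (\<lambda>Z. X Z i) \<in> P \<rightarrow>\<^sub>M M) \<and>
          integrable P (\<lambda>Z. wce H ip M (quadrature (s + 1) (w Z) (X Z))) \<and>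
          (\<integral>Z. wce H ip M (quadrature (s + 1) (w Z) (X Z)) \<partial>P) \<le> bound))"
proof -
  obtain K0 where K0: "\<And>x. k x x \<le> K0"
    using assms(4) by (auto simp: bdd_above_def)
  define K where "K = max 1 K0"
  have nonneg: "0 \<le> \<sigma> i" if "1 \<le> i" for i
    using assms(6) that by (auto simp: ordered_eigenpairs_def)
  have sm: "summable (\<lambda>i. \<sigma> (Suc i))"
    by (rule exponential_decay_tail(1)[OF assms(9,10,11,12) nonneg])
  obtain S where S: "0 \<le> S" "\<And>m. eigenvalue_tail \<sigma> m \<le> S * exp (- (\<beta> / 2) * real m powr (1 / real d))"
    using exponential_decay_tail(2)[OF assms(9,10,11,12) nonneg] by blast
  interpret mercer_rkhs M k H ip \<sigma> e K
  proof (intro mercer_rkhs.intro mercer_rkhs_axioms.intro assms sm)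
    show "space M = UNIV" using sets_eq_imp_space_eq[OF assms(2)] by simp
    show "1 \<le> K" by (simp add: K_def)
    show "k x x \<le> K" for x using K0[of x] by (simp add: K_def)
  qed
  have tail_eq: "tail s = (\<Sum>\<^sub>\<infinity>i\<in>{s<..}. \<sigma> i)" for s by (simp add: eigenvalue_tail_def)
  obtain A1 where A1: "0 \<le> A1" "\<forall>l\<ge>3. \<exists>m G. 0 < G \<and>
    3 * sqrt (tail m) + 3 * (real m * K / sqrt (real G))
      + 2 * K * (real m ^ 2 * ln (2 * real G + 1)) / real l \<le> A1 * (ln (real l) ^ (2 * d + 1) / real l)"
    using truncation_parameters[OF assms(9,10) K_ge_1 S] by blast
  \<comment> \<open>\<open>A1\<close> comes from the parameter choice, 2 from the coefficient of
    \<open>sqrt (tail s)\<close>, and \<open>K\<close> from the estimate without the root.\<close>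
  define A where "A = K * (A1 + 2)"
  show ?thesis
    unfolding Let_def tail_eq[symmetric]
  proof (intro exI[of _ A] allI impI)
    fix l s :: nat
    assume "3 \<le> l \<and> 1 \<le> s \<and> s \<le> l"
    then have l: "3 \<le> l" and s: "1 \<le> s" "s \<le> l" by auto
    define P where "P = PiM {1..l} (\<lambda>_. M)"
    define X where "X = ln (real l) ^ (2 * d + 1) / real l"
    define T where "T = sqrt (tail s)"
    interpret P: prob_space P unfolding P_def by (rule prob_space_PiM_const)
    have T: "0 \<le> T" by (simp add: T_def tail_nonneg)
    have X: "1 / real l \<le> X"
      unfolding X_def by (rule divide_right_mono[OF one_le_power[OF one_le_ln[OF l]]]) simp
    then have X0: "0 \<le> X" using l by (meson divide_nonneg_nonneg of_nat_0_le_iff order_trans zero_le_one)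
    have base: "2 * T + A1 * X \<le> (A1 + 2) * (T + X)"
      using T X0 A1(1) by (simp add: algebra_simps)
    have base0: "0 \<le> (A1 + 2) * (T + X)" using T X0 A1(1) by simp
    have A_ge: "(A1 + 2) * (T + X) \<le> A * (T + X)"
      unfolding A_def using mult_right_mono[OF K_ge_1 base0] by (simp add: mult.assoc)
    obtain m G where G: "0 < G" and par: "3 * sqrt (tail m) + 3 * (real m * K / sqrt (real G))
      + 2 * K * (real m ^ 2 * ln (2 * real G + 1)) / real l \<le> A1 * X"
      using A1(2) l unfolding X_def by blast
    obtain B where B: "integrable P B"
      "(\<integral>Z. B Z \<partial>P) \<le> 2 * sqrt (tail s) + 3 * sqrt (tail m) + 3 * (real m * K / sqrt G)
        + 2 * K * (real m ^ 2 * ln (2 * real G + 1)) / l"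
      and B_ge: "\<And>Z U lam. ordered_eigendecomposition l (\<lambda>i j. k (Z i) (Z j)) U lam \<Longrightarrow>
        (\<integral>x. sqrt (k x x - nystroem k l Z U lam s x x) \<partial>M) \<le> B Z"
    proof (rule nystroem_expectation_bound[OF s G, of m])
      fix B assume "integrable (PiM {1..l} (\<lambda>_. M)) B"
        "(\<integral>Z. B Z \<partial>PiM {1..l} (\<lambda>_. M)) \<le> 2 * sqrt (tail s) + 3 * sqrt (tail m)
          + 3 * (real m * K / sqrt G) + 2 * K * (real m ^ 2 * ln (2 * real G + 1)) / l"
        "\<And>Z U lam. ordered_eigendecomposition l (\<lambda>i j. k (Z i) (Z j)) U lam \<Longrightarrow>
          (\<integral>x. sqrt (k x x - nystroem k l Z U lam s x x) \<partial>M) \<le> B Z"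
      then show thesis unfolding P_def[symmetric] by (rule that)
    qed
    have EB: "(\<integral>Z. B Z \<partial>P) \<le> (A1 + 2) * (T + X)"
      using B(2) par base unfolding T_def by linarith
    have nys: "integrable P (\<lambda>Z. \<integral>x. sqrt (k x x - nystroem k l Z (U Z) (lam Z) s x x) \<partial>M) \<and>
      (\<integral>Z. (\<integral>x. sqrt (k x x - nystroem k l Z (U Z) (lam Z) s x x) \<partial>M) \<partial>P) \<le> A * (T + X) \<and>
      integrable P (\<lambda>Z. \<integral>x. (k x x - nystroem k l Z (U Z) (lam Z) s x x) \<partial>M) \<and>
      (\<integral>Z. (\<integral>x. (k x x - nystroem k l Z (U Z) (lam Z) s x x) \<partial>M) \<partial>P) \<le> A * (T + X)"
      if dec: "\<forall>Z\<in>space P. ordered_eigendecomposition l (\<lambda>i j. k (Z i) (Z j)) (U Z) (lam Z)"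
        and meas: "(\<lambda>(Z, x). nystroem k l Z (U Z) (lam Z) s x x) \<in> borel_measurable (P \<Otimes>\<^sub>M M)"
      for U lam
    proof -
      define f where "f Z x = k x x - nystroem k l Z (U Z) (lam Z) s x x" for Z x
      have nm: "(\<lambda>p. nystroem k l (fst p) (U (fst p)) (lam (fst p)) s (snd p) (snd p)) \<in> borel_measurable (P \<Otimes>\<^sub>M M)"
        using meas by (simp add: case_prod_beta')
      have km: "(\<lambda>p. k (snd p) (snd p)) \<in> borel_measurable (P \<Otimes>\<^sub>M M)"
        by (rule measurable_compose[OF measurable_snd kernel_diag_measurable])
      have fm: "(\<lambda>(Z, x). f Z x) \<in> borel_measurable (P \<Otimes>\<^sub>M M)"
        unfolding f_def case_prod_beta' using borel_measurable_diff[OF km nm] .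
      then have sfm: "(\<lambda>(Z, x). sqrt (f Z x)) \<in> borel_measurable (P \<Otimes>\<^sub>M M)"
        using measurable_compose[OF fm borel_measurable_sqrt] by (simp add: case_prod_beta')
      define F where "F Z = (\<integral>x. sqrt (f Z x) \<partial>M)" for Z
      define F' where "F' Z = (\<integral>x. f Z x \<partial>M)" for Z
      \<comment> \<open>Joint measurability makes the inner integrals measurable in
        \<open>Z\<close>; domination by \<open>B\<close> then gives integrability.\<close>
      have F_m: "F \<in> borel_measurable P" "F' \<in> borel_measurable P"
        unfolding F_def[abs_def] F'_def[abs_def]
        using borel_measurable_lebesgue_integral[OF sfm] borel_measurable_lebesgue_integral[OF fm] by auto
      have F_B: "0 \<le> F Z" "F Z \<le> B Z" "0 \<le> F' Z" "F' Z \<le> K * F Z" if "Z \<in> space P" for Z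
      proof -
        note dec_Z = dec[rule_format, OF that]
        have f0: "0 \<le> f Z x" for x unfolding f_def by (rule nystroem_residual_bounds(1)[OF dec_Z s])
        then show "0 \<le> F Z" "0 \<le> F' Z"
          unfolding F_def F'_def by (intro Bochner_Integration.integral_nonneg; simp)+
        show "F Z \<le> B Z" unfolding F_def f_def by (rule B_ge[OF dec_Z])
        show "F' Z \<le> K * F Z" unfolding F_def F'_def f_def by (rule nystroem_residual_le_sqrt[OF dec_Z s])
      qed
      have iF: "integrable P F"
      proof (rule Bochner_Integration.integrable_bound[OF B(1) F_m(1)], rule AE_I2)
        fix Z assume "Z \<in> space P"
        then show "norm (F Z) \<le> norm (B Z)" using F_B(1,2)[of Z] by simp
      qed
      have iF': "integrable P F'"
      proof (rule Bochner_Integration.integrable_bound[OF _ F_m(2)])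
        show "integrable P (\<lambda>Z. K * F Z)" using iF by simp
        show "AE Z in P. norm (F' Z) \<le> norm (K * F Z)"
          using F_B K_ge_1 by (intro AE_I2) (auto simp: abs_of_nonneg)
      qed
      have EF: "(\<integral>Z. F Z \<partial>P) \<le> (A1 + 2) * (T + X)"
        using integral_mono[OF iF B(1) F_B(2)] EB by linarith
      have "(\<integral>Z. F' Z \<partial>P) \<le> (\<integral>Z. K * F Z \<partial>P)"
        by (intro integral_mono iF' integrable_mult_right iF F_B(4))
      also have "\<dots> = K * (\<integral>Z. F Z \<partial>P)" by simp
      also have "\<dots> \<le> K * ((A1 + 2) * (T + X))" using EF K_ge_1 by (intro mult_left_mono) auto
      finally have EF': "(\<integral>Z. F' Z \<partial>P) \<le> A * (T + X)" by (simp add: A_def mult.assoc)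
      show ?thesis
        using iF iF' EF' order_trans[OF EF A_ge] unfolding F_def F'_def f_def by blast
    qed
    \<comment> \<open>Chosen so that the discretization error \<open>(s + 1) * \<epsilon>\<close>
      equals \<open>1 / l\<close>, which is at most \<open>X\<close>.\<close>
    define \<epsilon> where "\<epsilon> = 1 / (real l * (real s + 1))"
    have "0 < \<epsilon>" using l by (simp add: \<epsilon>_def)
    then obtain w Y where w: "convex_weights (s + 1) w"
      and wce: "wce H ip M (quadrature (s + 1) w Y) \<le> 2 * sqrt (tail s) + (real s + 1) * \<epsilon>"
      by (rule convex_quadrature_exists)
    have "real s + 1 \<noteq> 0" by linarith
    then have "(real s + 1) * \<epsilon> = 1 / real l" using l by (simp add: \<epsilon>_def)
    then have "wce H ip M (quadrature (s + 1) w Y) \<le> 2 * T + 1 / real l" using wce by (simp add: T_def)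
    also have "\<dots> \<le> 2 * T + 2 * X" using X X0 by linarith
    also have "\<dots> \<le> (A1 + 2) * (T + X)"
      using mult_nonneg_nonneg[OF A1(1), of "T + X"] T X0 by (simp add: algebra_simps)
    finally have wce': "wce H ip M (quadrature (s + 1) w Y) \<le> A * (T + X)" using A_ge by linarith
    \<comment> \<open>Weights and nodes are taken constant in \<open>Z\<close>, so measurability is
      immediate and the expected error is the error itself.\<close>
    have quad: "\<exists>(w :: (nat \<Rightarrow> 'a) \<Rightarrow> nat \<Rightarrow> real) (x :: (nat \<Rightarrow> 'a) \<Rightarrow> nat \<Rightarrow> 'a).
      (\<forall>Z\<in>space P. convex_weights (s + 1) (w Z)) \<and>
      (\<forall>i\<in>{1..s + 1}. (\<lambda>Z. w Z i) \<in> borel_measurable P \<and> (\<lambda>Z. x Z i) \<in> P \<rightarrow>\<^sub>M M) \<and>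
      integrable P (\<lambda>Z. wce H ip M (quadrature (s + 1) (w Z) (x Z))) \<and>
      (\<integral>Z. wce H ip M (quadrature (s + 1) (w Z) (x Z)) \<partial>P) \<le> A * (T + X)"
      using w wce'
      by (intro exI[of _ "\<lambda>_. w"] exI[of _ "\<lambda>_. Y"]) (simp add: P.prob_space space_M)
    show "(\<forall>U lam.
          (\<forall>Z\<in>space (PiM {1..l} (\<lambda>_. M)). ordered_eigendecomposition l (\<lambda>i j. k (Z i) (Z j)) (U Z) (lam Z)) \<and>
          (\<lambda>(Z, x). nystroem k l Z (U Z) (lam Z) s x x) \<in> borel_measurable (PiM {1..l} (\<lambda>_. M) \<Otimes>\<^sub>M M)
          \<longrightarrow>
          integrable (PiM {1..l} (\<lambda>_. M)) (\<lambda>Z. \<integral>x. sqrt (k x x - nystroem k l Z (U Z) (lam Z) s x x) \<partial>M) \<and>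
          (\<integral>Z. (\<integral>x. sqrt (k x x - nystroem k l Z (U Z) (lam Z) s x x) \<partial>M) \<partial>(PiM {1..l} (\<lambda>_. M)))
            \<le> A * (sqrt (tail s) + (ln (real l)) ^ (2 * d + 1) / real l) \<and>
          integrable (PiM {1..l} (\<lambda>_. M)) (\<lambda>Z. \<integral>x. (k x x - nystroem k l Z (U Z) (lam Z) s x x) \<partial>M) \<and>
          (\<integral>Z. (\<integral>x. (k x x - nystroem k l Z (U Z) (lam Z) s x x) \<partial>M) \<partial>(PiM {1..l} (\<lambda>_. M)))
            \<le> A * (sqrt (tail s) + (ln (real l)) ^ (2 * d + 1) / real l)) \<and>
       (\<exists>(w :: (nat \<Rightarrow> 'a) \<Rightarrow> nat \<Rightarrow> real) (X :: (nat \<Rightarrow> 'a) \<Rightarrow> nat \<Rightarrow> 'a).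
          (\<forall>Z\<in>space (PiM {1..l} (\<lambda>_. M)). convex_weights (s + 1) (w Z)) \<and>
          (\<forall>i\<in>{1..s + 1}. (\<lambda>Z. w Z i) \<in> borel_measurable (PiM {1..l} (\<lambda>_. M)) \<and>
            (\<lambda>Z. X Z i) \<in> (PiM {1..l} (\<lambda>_. M)) \<rightarrow>\<^sub>M M) \<and>
          integrable (PiM {1..l} (\<lambda>_. M)) (\<lambda>Z. wce H ip M (quadrature (s + 1) (w Z) (X Z))) \<and>
          (\<integral>Z. wce H ip M (quadrature (s + 1) (w Z) (X Z)) \<partial>(PiM {1..l} (\<lambda>_. M)))
            \<le> A * (sqrt (tail s) + (ln (real l)) ^ (2 * d + 1) / real l))"
      unfolding P_def[symmetric] X_def[symmetric] T_def[symmetric]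
      using nys quad by blast
  qed
qed

end
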